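(* Let $q$ be a prime power, let $n \geq 2$ be an integer, and let $c$ be a Singer cycle in $GL_n(\mathbb{F}_q)$. Let $t_q(n,n)$ denote the number of ordered $n$-tuples $(t_1,\ldots,t_n)$ of reflections in $GL_n(\mathbb{F}_q)$ such that $c=t_1t_2\cdots t_n$. Then $$t_q(n,n)=(q^n-1)^{n-1}.$$
   Context: A Singer cycle in $GL_n(\mathbb{F}_q)$ is the image of a generator of the cyclic group $\mathbb{F}_{q^n}^\times$ under an embedding $\mathbb{F}_{q^n}^\times \hookrightarrow GL_{\mathbb{F}_q}(\mathbb{F}_{q^n}) \cong GL_n(\mathbb{F}_q)$ (acting by multiplication) coming from some choice of $\mathbb{F}_q$-vector space isomorphism $\mathbb{F}_{q^n}\cong \mathbb{F}_q^n$. A reflection in $GL_n(\mathbb{F}_q)$ is an element $t$ whose fixed space $(\mathbb{F}_q^n)^t=\{v: tv=v\}$ is a hyperplane (a linear subspace of dimension $n-1$) in $\mathbb{F}_q^n$; reflections of determinant $1$ (transvections) are included. *)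

theory Defs
  imports "HOL-Analysis.Analysis"
begin

text \<open>
  The field with \<open>q\<close> elements is a type \<open>'a :: {field, finite}\<close>, and
  matrices act on column vectors by \<open>*v\<close>, with product \<open>**\<close>.
  (The operator \<open>*\<close> on these types is componentwise.)
\<close>

definition field_embedding :: "('a::field \<Rightarrow> 'b::field) \<Rightarrow> bool" where
  "field_embedding \<iota> \<longleftrightarrow>
     \<iota> 1 = 1 \<and> (\<forall>a b. \<iota> (a + b) = \<iota> a + \<iota> b) \<and> (\<forall>a b. \<iota> (a * b) = \<iota> a * \<iota> b)"

definition generates_units :: "'b::field \<Rightarrow> bool" where
  "generates_units \<zeta> \<longleftrightarrow> range (\<lambda>k::int. \<zeta> powi k) = UNIV - {0}"

text \<open>
  Here \<open>\<iota>\<close> presents \<open>'b\<close> as an extension of \<open>'a\<close>, so that \<open>'b\<close> is an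
  \<open>'a\<close>-vector space with scalar multiplication \<open>\<iota> a * x\<close>, and \<open>\<phi>\<close> is the chosen
  isomorphism of \<open>'a\<close>-vector spaces. The last conjunct says that \<open>c\<close> is the matrix of
  \<open>\<phi> \<circ> (*) \<zeta> \<circ> inv \<phi>\<close>.
\<close>

definition singer_cycle :: "('a::field \<Rightarrow> 'b::field) \<Rightarrow> 'a^'n^'n \<Rightarrow> bool" where
  "singer_cycle \<iota> c \<longleftrightarrow>
     (\<exists>(\<phi> :: 'b \<Rightarrow> 'a^'n) \<zeta>.
        Vector_Spaces.linear (\<lambda>a x. \<iota> a * x) (*s) \<phi> \<and> bij \<phi> \<and>
        generates_units \<zeta> \<and>
        (\<forall>x. c *v \<phi> x = \<phi> (\<zeta> * x)))"

definition fixed_space :: "'a::field^'n^'n \<Rightarrow> ('a^'n) set" where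
  "fixed_space t = {v. t *v v = v}"

definition is_reflection :: "'a::field^'n^'n \<Rightarrow> bool" where
  "is_reflection t \<longleftrightarrow> invertible t \<and> vec.dim (fixed_space t) = CARD('n) - 1"

definition reflection_factorizations :: "'a::field^'n^'n \<Rightarrow> nat \<Rightarrow> ('a^'n^'n) list set" where
  "reflection_factorizations c l =
     {ts. length ts = l \<and> (\<forall>t\<in>set ts. is_reflection t) \<and> c = foldr (**) ts (mat 1)}"

end

theory Submission
  imports Defs "Jordan_Normal_Form.Determinant"
begin

text \<open>
  Let \<open>q = CARD('a)\<close> and \<open>n = CARD('n)\<close>. The Singer cycle \<open>c\<close> enters through two
  properties: it is invertible, and it stabilises no subspace other than \<open>0\<close> and the whole space.

  Let \<open>c = t\<^sub>1 \<dots> t\<^sub>n\<close> with reflections \<open>t\<^sub>i\<close>, and let \<open>a\<^sub>k\<close> be the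
  product of the first \<open>k\<close> of them. The space \<open>y\<^sub>k\<close> of fixed vectors of \<open>a\<^sub>k\<close> has codimension at most
  \<open>k\<close>, the space \<open>x\<^sub>k\<close> on which \<open>a\<^sub>k\<close> agrees with \<open>c\<close> has dimension at least \<open>k\<close>, and they meet in \<open>0\<close>
  because \<open>c\<close> fixes no nonzero vector. So both bounds are sharp, and \<open>x\<close> and \<open>y\<close> are complete flags
  such that \<open>y\<close> is opposite to \<open>x\<close> and to \<open>c x\<close>. Conversely such a pair determines every \<open>a\<^sub>k\<close>: it is
  \<open>c\<close> on \<open>x\<^sub>k\<close> and the identity on \<open>y\<^sub>k\<close>. Hence the factorizations are in bijection with the pairs
  of flags \<open>(x, y)\<close> with \<open>y\<close> opposite to \<open>x\<close> and \<open>c x\<close> (\<open>card_reflection_factorizations_eq\<close>).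

  Two flags are opposite iff they are joined by a gallery whose
  type is a reduced word \<open>w\<close> of the longest permutation, and this gallery is then unique. The pairs
  \<open>(x, y)\<close> are therefore counted by the galleries of type \<open>w\<close> followed by the reverse of \<open>w\<close>, the
  word of the full twist, that lead from some \<open>x\<close> to \<open>c x\<close>. For an arbitrary word the number of
  galleries from \<open>x\<close> to \<open>c x\<close>, summed over \<open>x\<close>, satisfies the relations of the Hecke algebra
  (\<open>T\<^sub>i\<^sup>2 = (q - 1) T\<^sub>i + q\<close> and the braid relations), is invariant under rotation of the word, and
  vanishes on words that omit a letter, since \<open>c\<close> would stabilise the subspace that such a gallery
  never changes. On the Coxeter word \<open>0, 1, \<dots>, n - 2\<close> it counts the Krylov flags of lines under
  \<open>c\<close>, so its value is \<open>1 + q + \<dots> + q\<^bsup>n-1\<^esup>\<close>.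

  A function on words with these properties is determined by its value on the
  Coxeter word (\<open>elliptic_trace_unique\<close>): the braid and quadratic relations reduce any word to
  words in which the largest letter occurs at most once, rotation passes to fewer letters, and so
  on. Now \<open>q\<^bsup>length w\<^esup> det (1 - \<rho> w)\<close>, where \<open>\<rho>\<close> is the reduced Burau representation with
  parameter \<open>1 / q\<close>, is another such function with the same value on the Coxeter word; as with
  the Alexander polynomial, the quadratic relation becomes a skein relation. So the two functions
  coincide. The full twist acts in the reduced Burau representation as the scalar \<open>q\<^bsup>-n\<^esup>\<close> and its
  word has length \<open>n (n - 1)\<close>; the determinant gives \<open>q\<^bsup>n(n-1)\<^esup> (1 - q\<^bsup>-n\<^esup>)\<^bsup>n-1\<^esup> = (q\<^bsup>n\<^esup> - 1)\<^bsup>n-1\<^esup>\<close>.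

  Throughout, \<open>m\<close> stands for \<open>n - 1\<close> and the generators of the Hecke algebra are numbered
  \<open>0, \<dots>, m - 1\<close>.
\<close>

section \<open>Linear functionals on Hecke algebras of type A\<close>

text \<open>
  Linear functionals on the Hecke algebra with generators \<open>T\<^sub>0, \<dots>, T\<^bsub>m-1\<^esub>\<close> and relation
  \<open>T\<^sub>i\<^sup>2 = (q - 1) T\<^sub>i + q\<close>, recorded by their values on the monomials in the generators. Stating
  the relations inside arbitrary contexts \<open>u\<close>, \<open>v\<close> replaces the passage to the quotient of the free
  algebra.
\<close>

definition hecke_functional :: "real \<Rightarrow> nat \<Rightarrow> (nat list \<Rightarrow> real) \<Rightarrow> bool" where
  "hecke_functional q m g \<longleftrightarrow>
     (\<forall>u v i. i < m \<longrightarrow> g (u @ [i, i] @ v) = (q - 1) * g (u @ [i] @ v) + q * g (u @ v)) \<and>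
     (\<forall>u v i. Suc i < m \<longrightarrow> g (u @ [i, Suc i, i] @ v) = g (u @ [Suc i, i, Suc i] @ v)) \<and>
     (\<forall>u v i j. Suc i < j \<longrightarrow> j < m \<longrightarrow> g (u @ [i, j] @ v) = g (u @ [j, i] @ v))"

lemma hecke_functionalD:
  assumes "hecke_functional q m g"
  shows "i < m \<Longrightarrow> g (u @ [i, i] @ v) = (q - 1) * g (u @ [i] @ v) + q * g (u @ v)"
    and "Suc i < m \<Longrightarrow> g (u @ [i, Suc i, i] @ v) = g (u @ [Suc i, i, Suc i] @ v)"
    and "Suc i < j \<Longrightarrow> j < m \<Longrightarrow> g (u @ [i, j] @ v) = g (u @ [j, i] @ v)"
  using assms unfolding hecke_functional_def by blast+

lemma hecke_functional_context:
  assumes "hecke_functional q m g"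
  shows "hecke_functional q m (\<lambda>w. g (a @ w @ b))"
  unfolding hecke_functional_def
proof (intro conjI allI impI)
  fix u v i assume "i < m"
  then show "g (a @ (u @ [i, i] @ v) @ b) = (q - 1) * g (a @ (u @ [i] @ v) @ b) + q * g (a @ (u @ v) @ b)"
    using hecke_functionalD(1)[OF assms, of i "a @ u" "v @ b"] by simp
next
  fix u v i assume "Suc i < m"
  then show "g (a @ (u @ [i, Suc i, i] @ v) @ b) = g (a @ (u @ [Suc i, i, Suc i] @ v) @ b)"
    using hecke_functionalD(2)[OF assms, of i "a @ u" "v @ b"] by simp
next
  fix u v i j assume "Suc i < j" "j < m"
  then show "g (a @ (u @ [i, j] @ v) @ b) = g (a @ (u @ [j, i] @ v) @ b)"
    using hecke_functionalD(3)[OF assms, of i j "a @ u" "v @ b"] by simp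
qed

lemma hecke_functional_diff:
  assumes "hecke_functional q m g" "hecke_functional q m h"
  shows "hecke_functional q m (\<lambda>w. g w - h w)"
  unfolding hecke_functional_def
proof (intro conjI allI impI)
  fix u v i assume "i < m"
  then show "g (u @ [i, i] @ v) - h (u @ [i, i] @ v) =
      (q - 1) * (g (u @ [i] @ v) - h (u @ [i] @ v)) + q * (g (u @ v) - h (u @ v))"
    using assms[THEN hecke_functionalD(1), of i u v] by (simp only:) (simp add: algebra_simps)
next
  fix u v i assume "Suc i < m"
  then show "g (u @ [i, Suc i, i] @ v) - h (u @ [i, Suc i, i] @ v) =
      g (u @ [Suc i, i, Suc i] @ v) - h (u @ [Suc i, i, Suc i] @ v)"
    using assms[THEN hecke_functionalD(2), of i u v] by (simp only:)
next
  fix u v i j assume "Suc i < j" "j < m"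
  then show "g (u @ [i, j] @ v) - h (u @ [i, j] @ v) = g (u @ [j, i] @ v) - h (u @ [j, i] @ v)"
    using assms[THEN hecke_functionalD(3), of i j u v] by (simp only:)
qed

lemma hecke_functional_commute_letter:
  assumes g: "hecke_functional q m g" and k: "k < m" and b: "\<forall>i\<in>set b. Suc i < k"
  shows "g (u @ [k] @ b @ v) = g (u @ b @ [k] @ v)"
  using b
proof (induction b arbitrary: u)
  case Nil
  then show ?case by simp
next
  case (Cons i b)
  have "g (u @ [k] @ (i # b) @ v) = g (u @ [k, i] @ b @ v)"
    by simp
  also have "\<dots> = g (u @ [i, k] @ b @ v)"
    using hecke_functionalD(3)[OF g, of i k u "b @ v"] Cons.prems k by simp
  also have "\<dots> = g ((u @ [i]) @ [k] @ b @ v)"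
    by simp
  also have "\<dots> = g ((u @ [i]) @ b @ [k] @ v)"
    using Cons by (intro Cons.IH) auto
  finally show ?case by simp
qed

lemma hecke_functional_commute_words:
  assumes g: "hecke_functional q m g"
    and "\<forall>i\<in>set b. \<forall>j\<in>set c. Suc i < j" "\<forall>j\<in>set c. j < m"
  shows "g (u @ b @ c @ v) = g (u @ c @ b @ v)"
  using assms(2,3)
proof (induction c arbitrary: u)
  case Nil
  then show ?case by simp
next
  case (Cons j c)
  have "g (u @ b @ (j # c) @ v) = g (u @ b @ [j] @ c @ v)"
    by simp
  also have "\<dots> = g (u @ [j] @ b @ c @ v)"
    using Cons.prems by (intro hecke_functional_commute_letter[OF g, symmetric]) auto
  also have "\<dots> = g ((u @ [j]) @ b @ c @ v)"
    by simp
  also have "\<dots> = g ((u @ [j]) @ c @ b @ v)"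
    using Cons by (intro Cons.IH) auto
  finally show ?case by simp
qed

lemma split_list_two_occurrences:
  assumes "count_list w k \<ge> 2"
  obtains a b c where "w = a @ [k] @ b @ [k] @ c" "k \<notin> set b"
proof -
  have "k \<in> set w"
    using assms count_notin by fastforce
  then obtain a w' where w: "w = a @ k # w'" "k \<notin> set a"
    by (meson split_list_first)
  have "count_list a k = 0" using w(2) by simp
  then have "count_list w' k \<ge> 1" using assms w(1) by simp
  then have "k \<in> set w'"
    using count_notin by fastforce
  then obtain b c where "w' = b @ k # c" "k \<notin> set b"
    by (meson split_list_first)
  with w show ?thesis
    by (intro that[of a b c]) auto
qed

text \<open>
  This is the fact that the Hecke algebra \<open>H\<^sub>k\<close> on the letters up to \<open>k\<close> is spanned by
  \<open>H\<^bsub>k-1\<^esub>\<close> and \<open>H\<^bsub>k-1\<^esub> T\<^sub>k H\<^bsub>k-1\<^esub>\<close>: two occurrences of \<open>k\<close> can always be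
  brought together, and then the quadratic or the braid relation removes one of them. The induction
  on \<open>k\<close> needs the statement for all functionals, because it is applied to the functional that
  inserts a word between two occurrences of \<open>k\<close>.
\<close>

lemma hecke_functional_zero_if_top_letter_once:
  assumes g: "hecke_functional q m g" and "k < m"
    and once: "\<And>w. set w \<subseteq> {..k} \<Longrightarrow> count_list w k \<le> 1 \<Longrightarrow> g w = 0"
    and "set w \<subseteq> {..k}"
  shows "g w = 0"
  using assms
proof (induction k arbitrary: g w)
  case 0
  show ?case
    using \<open>set w \<subseteq> {..0}\<close>
  proof (induction "length w" arbitrary: w rule: less_induct)
    case less
    show ?case
    proof (cases "count_list w 0 \<le> 1")
      case True
      then show ?thesis using 0 less.prems by blast
    next
      case False
      then obtain a b c where w: "w = a @ [0] @ b @ [0] @ c" "0 \<notin> set b"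
        by (metis split_list_two_occurrences not_less_eq_eq numeral_2_eq_2 One_nat_def)
      have "b = []" using w less.prems by (cases b) auto
      then have "g w = (q - 1) * g (a @ [0] @ c) + q * g (a @ c)"
        using hecke_functionalD(1)[OF \<open>hecke_functional q m g\<close> \<open>0 < m\<close>, of a c] w by simp
      moreover have "g (a @ [0] @ c) = 0" "g (a @ c) = 0"
        using less.prems w by (auto intro!: less.hyps)
      ultimately show ?thesis by simp
    qed
  qed
next
  case (Suc k')
  let ?k = "Suc k'"
  note g = \<open>hecke_functional q m g\<close>
  have "k' < m" using Suc.prems by simp
  show ?case
    using \<open>set w \<subseteq> {..?k}\<close>
  proof (induction "count_list w ?k" arbitrary: w rule: less_induct)
    case less
    show ?case
    proof (cases "count_list w ?k \<le> 1")
      case True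
      then show ?thesis using Suc.prems(3) less.prems by blast
    next
      case False
      then obtain a b c where w: "w = a @ [?k] @ b @ [?k] @ c" and kb: "?k \<notin> set b"
        by (metis split_list_two_occurrences not_less_eq_eq numeral_2_eq_2 One_nat_def)
      have abc: "set a \<subseteq> {..?k}" "set c \<subseteq> {..?k}" and "set b \<subseteq> {..?k}"
        using less.prems w by auto
      then have b: "set b \<subseteq> {..k'}" using kb by (metis atMost_Suc subset_insert)
      \<comment> \<open>Between two consecutive occurrences of \<open>k\<close> the word \<open>b\<close> has smaller letters only. By the
        hypothesis for \<open>k - 1\<close> it may be assumed to contain \<open>k - 1\<close> at most once. If it does not contain
        it, the two \<open>k\<close> meet; otherwise they meet at \<open>k - 1\<close> and the braid relation applies.\<close>
      have small: "set b \<subseteq> {..k'} \<Longrightarrow> count_list b k' \<le> 1 \<Longrightarrow> g ((a @ [?k]) @ b @ [?k] @ c) = 0" for b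
      proof -
        assume b: "set b \<subseteq> {..k'}" "count_list b k' \<le> 1"
        show "g ((a @ [?k]) @ b @ [?k] @ c) = 0"
        proof (cases "k' \<in> set b")
          case False
          then have b': "\<forall>i\<in>set b. Suc i < ?k"
            using b(1) by (metis Suc_mono atMost_iff le_neq_implies_less subsetD)
          have kb: "?k \<notin> set b" using b(1) by auto
          have "g ((a @ [?k]) @ b @ [?k] @ c) = g ((a @ b) @ [?k, ?k] @ c)"
            using hecke_functional_commute_letter[OF g \<open>?k < m\<close> b', of a "[?k] @ c"] by simp
          also have "\<dots> = (q - 1) * g ((a @ b) @ [?k] @ c) + q * g ((a @ b) @ c)"
            by (rule hecke_functionalD(1)[OF g \<open>?k < m\<close>])
          also have "g ((a @ b) @ [?k] @ c) = 0"
            using abc b kb by (intro less.hyps) (auto simp: w)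
          also have "g ((a @ b) @ c) = 0"
            using abc b kb by (intro less.hyps) (auto simp: w)
          finally show ?thesis by simp
        next
          case True
          then obtain b1 b2 where b12: "b = b1 @ k' # b2" "k' \<notin> set b1"
            by (meson split_list_first)
          then have "k' \<notin> set b2" using b(2) by (auto simp: count_list_0_iff)
          then have b': "\<forall>i\<in>set b1. Suc i < ?k" "\<forall>i\<in>set b2. Suc i < ?k"
            using b(1) b12 by (auto simp: le_less)
          have kb: "?k \<notin> set b1" "?k \<notin> set b2" using b(1) b12 by auto
          have "g ((a @ [?k]) @ b @ [?k] @ c) = g (a @ [?k] @ b1 @ (k' # b2 @ [?k] @ c))"
            by (simp add: b12)
          also have "\<dots> = g ((a @ b1 @ [?k, k']) @ b2 @ [?k] @ c)"
            by (subst hecke_functional_commute_letter[OF g \<open>?k < m\<close> b'(1)]) simp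
          also have "\<dots> = g ((a @ b1) @ [?k, k', ?k] @ (b2 @ c))"
            by (subst hecke_functional_commute_letter[OF g \<open>?k < m\<close> b'(2), symmetric]) simp
          also have "\<dots> = g ((a @ b1) @ [k', ?k, k'] @ (b2 @ c))"
            by (rule hecke_functionalD(2)[OF g \<open>?k < m\<close>, symmetric])
          also have "\<dots> = 0"
            using abc b b12 kb by (intro less.hyps) (auto simp: w)
          finally show ?thesis .
        qed
      qed
      have "g ((a @ [?k]) @ b @ [?k] @ c) = 0"
        by (rule Suc.IH[OF hecke_functional_context[OF g] \<open>k' < m\<close> small b])
      then show ?thesis by (simp add: w)
    qed
  qed
qed

text \<open>
  Modelled on the trace of Hecke operators composed with the action on flags of a matrix without
  proper stable subspaces. Rotation invariance is the trace property. A word that omits a letter lies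
  in a proper parabolic subalgebra, whose elements keep one subspace of each flag; the matrix moves
  every such subspace.
\<close>

definition elliptic_trace :: "real \<Rightarrow> nat \<Rightarrow> (nat list \<Rightarrow> real) \<Rightarrow> bool" where
  "elliptic_trace q m f \<longleftrightarrow> hecke_functional q m f \<and>
     (\<forall>i w. i < m \<longrightarrow> set w \<subseteq> {..<m} \<longrightarrow> f (i # w) = f (w @ [i])) \<and>
     (\<forall>i w. i < m \<longrightarrow> set w \<subseteq> {..<m} \<longrightarrow> i \<notin> set w \<longrightarrow> f w = 0)"

lemma elliptic_trace_rotate:
  assumes "elliptic_trace q m f" "set u \<subseteq> {..<m}" "set v \<subseteq> {..<m}"
  shows "f (u @ v) = f (v @ u)"
  using assms(2,3)
proof (induction u arbitrary: v)
  case (Cons i u)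
  have "f ((i # u) @ v) = f (i # (u @ v))" by simp
  also have "\<dots> = f ((u @ v) @ [i])"
    using assms(1) Cons.prems unfolding elliptic_trace_def by (metis Un_subset_iff insert_subset lessThan_iff list.simps(15) set_append)
  also have "\<dots> = f (u @ (v @ [i]))" by simp
  also have "\<dots> = f ((v @ [i]) @ u)"
    using Cons.prems by (intro Cons.IH) auto
  finally show ?case by simp
qed simp

text \<open>
  Downward from \<open>k = m\<close>, a word on the letters below \<open>k\<close> followed by \<open>k, \<dots>, m - 1\<close> can be assumed
  to contain \<open>k - 1\<close> exactly once; the part behind this letter commutes with \<open>k, \<dots>, m - 1\<close> and can be
  rotated to the front. This leaves a word on the letters below \<open>k - 1\<close> followed by
  \<open>k - 1, \<dots>, m - 1\<close>, and in the end the Coxeter word alone.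
\<close>

lemma elliptic_trace_eq_zero:
  assumes f: "elliptic_trace q m f" and cox: "f [0..<m] = 0" and w: "set w \<subseteq> {..<m}"
  shows "f w = 0"
proof -
  have hecke: "hecke_functional q m f"
    and vanish: "\<And>i w. i < m \<Longrightarrow> set w \<subseteq> {..<m} \<Longrightarrow> i \<notin> set w \<Longrightarrow> f w = 0"
    using f unfolding elliptic_trace_def by blast+
  have "f (u @ [k..<m]) = 0" if "k \<le> m" "set u \<subseteq> {..<k}" for k u
    using that
  proof (induction k arbitrary: u)
    case 0
    then show ?case using cox by simp
  next
    case (Suc k)
    have "k < m" using Suc.prems by simp
    have "f ([] @ u @ [Suc k..<m]) = 0"
    proof (rule hecke_functional_zero_if_top_letter_once[OF hecke_functional_context[OF hecke] \<open>k < m\<close>])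
      show "set u \<subseteq> {..k}" using Suc.prems by auto
    next
      fix v assume v: "set v \<subseteq> {..k}" "count_list v k \<le> 1"
      show "f ([] @ v @ [Suc k..<m]) = 0"
      proof (cases "k \<in> set v")
        case False
        then show ?thesis using v \<open>k < m\<close> by (intro vanish[of k]) auto
      next
        case True
        then obtain a b where ab: "v = a @ k # b" "k \<notin> set a"
          by (meson split_list_first)
        have "k \<notin> set b" using v(2) ab by (auto simp: count_list_0_iff)
        then have a: "set a \<subseteq> {..<k}" and b: "set b \<subseteq> {..<k}"
          using v(1) ab by (auto simp: le_less)
        have "f ([] @ v @ [Suc k..<m]) = f ((a @ [k]) @ b @ [Suc k..<m] @ [])"
          by (simp add: ab)
        also have "\<dots> = f ((a @ [k]) @ [Suc k..<m] @ b @ [])"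
          using b by (intro hecke_functional_commute_words[OF hecke]) auto
        also have "\<dots> = f ((a @ [k..<m]) @ b)"
          using \<open>k < m\<close> by (simp add: upt_rec)
        also have "\<dots> = f (b @ a @ [k..<m])"
          using a b \<open>k < m\<close> by (intro elliptic_trace_rotate[OF f]) auto
        also have "\<dots> = 0"
          using Suc.IH[of "b @ a"] a b \<open>k < m\<close> by simp
        finally show ?thesis .
      qed
    qed
    then show ?case by simp
  qed
  from this[of m w] w show ?thesis by simp
qed

lemma elliptic_trace_unique:
  assumes f: "elliptic_trace q m f" and g: "elliptic_trace q m g"
    and cox: "f [0..<m] = g [0..<m]" and w: "set w \<subseteq> {..<m}"
  shows "f w = g w"
proof -
  have "elliptic_trace q m (\<lambda>w. f w - g w)"
    using f g hecke_functional_diff[of q m f g] unfolding elliptic_trace_def by (simp; metis)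
  from elliptic_trace_eq_zero[OF this _ w] cox show ?thesis by simp
qed

section \<open>The Burau determinant\<close>

text \<open>
  The braid generator acts on two neighbouring coordinates by \<open>(a, b) \<mapsto> ((1 - t) a + t b, a)\<close>. This
  is the action of braids on colourings by an Alexander quandle; it fixes constant sequences.
\<close>

definition unreduced_burau :: "real \<Rightarrow> nat \<Rightarrow> (nat \<Rightarrow> real) \<Rightarrow> nat \<Rightarrow> real" where
  "unreduced_burau t i x = x(i := (1 - t) * x i + t * x (Suc i), Suc i := x i)"

lemma unreduced_burau_simps:
  "unreduced_burau t i x i = (1 - t) * x i + t * x (Suc i)"
  "unreduced_burau t i x (Suc i) = x i"
  "j \<noteq> i \<Longrightarrow> j \<noteq> Suc i \<Longrightarrow> unreduced_burau t i x j = x j"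
  by (simp_all add: unreduced_burau_def)

text \<open>
  The action on the differences of consecutive coordinates, that is, modulo constant sequences. Its
  advantage is that generator \<open>i\<close> only adds multiples of the coordinate \<open>i\<close> to coordinates, so that
  its matrix differs from the identity in a single column. Long words are easier to evaluate in the
  unreduced action.
\<close>

definition reduced_burau :: "real \<Rightarrow> nat \<Rightarrow> (nat \<Rightarrow> real) \<Rightarrow> nat \<Rightarrow> real" where
  "reduced_burau t i y =
     (\<lambda>j. if j = i then - t * y i else if Suc j = i then y j + t * y i
          else if j = Suc i then y j + y i else y j)"

definition differences :: "(nat \<Rightarrow> real) \<Rightarrow> nat \<Rightarrow> real" where
  "differences x = (\<lambda>j. x j - x (Suc j))"

lemma differences_unreduced_burau:
  "differences (unreduced_burau t i x) = reduced_burau t i (differences x)"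
  unfolding differences_def unreduced_burau_def reduced_burau_def
  by (rule ext) (auto simp: algebra_simps)

lemma surj_differences: "surj differences"
proof (rule surjI)
  fix y show "differences (\<lambda>j. - (\<Sum>l<j. y l)) = y"
    by (rule ext) (simp add: differences_def)
qed

lemma differences_foldr_unreduced_burau:
  "differences (foldr (unreduced_burau t) w x) = foldr (reduced_burau t) w (differences x)"
  by (induction w) (simp_all add: differences_unreduced_burau)

lemma reduced_burau_quadratic:
  "reduced_burau t i (reduced_burau t i y) j = (1 - t) * reduced_burau t i y j + t * y j"
  unfolding reduced_burau_def by (auto simp: algebra_simps)

lemma reduced_burau_braid:
  "reduced_burau t i (reduced_burau t (Suc i) (reduced_burau t i y)) =
   reduced_burau t (Suc i) (reduced_burau t i (reduced_burau t (Suc i) y))"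
  unfolding reduced_burau_def by (rule ext) (auto simp: algebra_simps)

lemma reduced_burau_commute:
  "Suc i < j \<Longrightarrow> reduced_burau t i (reduced_burau t j y) = reduced_burau t j (reduced_burau t i y)"
  unfolding reduced_burau_def by (rule ext) (auto simp: algebra_simps)

abbreviation unit_seq :: "nat \<Rightarrow> nat \<Rightarrow> real" where
  "unit_seq c \<equiv> (\<lambda>j. if j = c then 1 else 0)"

text \<open>
  The last generator writes to coordinate \<open>m\<close> of the infinite sequence. This is harmless,
  since it never flows back: on the first \<open>m\<close> coordinates the operators act as \<open>m \<times> m\<close> matrices.
\<close>

definition matrix_like :: "nat \<Rightarrow> ((nat \<Rightarrow> real) \<Rightarrow> nat \<Rightarrow> real) \<Rightarrow> bool" where
  "matrix_like m L \<longleftrightarrow> (\<forall>y r. r < m \<longrightarrow> L y r = (\<Sum>c<m. y c * L (unit_seq c) r))"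

lemma matrix_like_comp:
  assumes "matrix_like m L" "matrix_like m L'"
  shows "matrix_like m (\<lambda>y. L (L' y))"
  unfolding matrix_like_def
proof (intro allI impI)
  fix y r assume r: "r < m"
  have L: "L z r = (\<Sum>c<m. z c * L (unit_seq c) r)" for z
    using assms(1) r unfolding matrix_like_def by blast
  have "L (L' y) r = (\<Sum>c<m. (\<Sum>d<m. y d * L' (unit_seq d) c) * L (unit_seq c) r)"
    using assms(2) unfolding matrix_like_def by (subst L) (auto intro!: sum.cong)
  also have "\<dots> = (\<Sum>c<m. \<Sum>d<m. y d * (L' (unit_seq d) c * L (unit_seq c) r))"
    by (simp add: sum_distrib_right mult.assoc)
  also have "\<dots> = (\<Sum>d<m. \<Sum>c<m. y d * (L' (unit_seq d) c * L (unit_seq c) r))"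
    by (rule sum.swap)
  also have "\<dots> = (\<Sum>d<m. y d * (\<Sum>c<m. L' (unit_seq d) c * L (unit_seq c) r))"
    by (simp only: sum_distrib_left)
  also have "\<dots> = (\<Sum>d<m. y d * L (L' (unit_seq d)) r)"
    by (simp only: L[symmetric])
  finally show "L (L' y) r = (\<Sum>d<m. y d * L (L' (unit_seq d)) r)" .
qed

lemma matrix_like_reduced_burau:
  assumes i: "i < m"
  shows "matrix_like m (reduced_burau t i)"
  unfolding matrix_like_def
proof (intro allI impI)
  fix y :: "nat \<Rightarrow> real" and r assume r: "r < m"
  have pick: "(\<Sum>c<m. y c * (if d = c then a else 0)) = y d * a" if "d < m" for d a
  proof -
    have "(\<Sum>c<m. y c * (if d = c then a else 0)) = (\<Sum>c<m. if d = c then y c * a else 0)"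
      by (rule sum.cong) auto
    then show ?thesis using that by simp
  qed
  have "reduced_burau t i (unit_seq c) r =
      (if r = i then (if i = c then - t else 0) else (if r = c then 1 else 0) +
        (if Suc r = i then (if i = c then t else 0) else if r = Suc i then (if i = c then 1 else 0) else 0))" for c
    unfolding reduced_burau_def by auto
  then have "(\<Sum>c<m. y c * reduced_burau t i (unit_seq c) r) =
      (if r = i then y i * (- t) else y r * 1 +
        (if Suc r = i then y i * t else if r = Suc i then y i * 1 else 0))"
    using i r pick by (simp add: distrib_left sum.distrib del: mult_minus_right)
  also have "\<dots> = reduced_burau t i y r"
    unfolding reduced_burau_def by auto
  finally show "reduced_burau t i y r = (\<Sum>c<m. y c * reduced_burau t i (unit_seq c) r)" ..
qed

lemma matrix_like_foldr_reduced_burau: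
  "set w \<subseteq> {..<m} \<Longrightarrow> matrix_like m (foldr (reduced_burau t) w)"
proof (induction w)
  case Nil
  have pick: "(\<Sum>c<m. y c * unit_seq c r) = y r" if "r < m" for y :: "nat \<Rightarrow> real" and r
  proof -
    have "(\<Sum>c<m. y c * unit_seq c r) = (\<Sum>c<m. if r = c then y c else 0)"
      by (rule sum.cong) auto
    then show ?thesis using that by simp
  qed
  then show ?case by (simp add: matrix_like_def)
next
  case (Cons i w)
  then show ?case
    using matrix_like_comp[OF matrix_like_reduced_burau, of i m "foldr (reduced_burau t) w"]
    by (simp add: comp_def)
qed

definition burau_mat :: "real \<Rightarrow> nat \<Rightarrow> nat list \<Rightarrow> real Matrix.mat" where
  "burau_mat t m w = Matrix.mat m m (\<lambda>(r, c). foldr (reduced_burau t) w (unit_seq c) r)"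

lemma burau_mat_carrier [simp]: "burau_mat t m w \<in> carrier_mat m m"
  by (simp add: burau_mat_def)

lemma burau_mat_append:
  assumes "set u \<subseteq> {..<m}"
  shows "burau_mat t m (u @ v) = burau_mat t m u * burau_mat t m v"
proof (rule eq_matI)
  fix r c assume "r < dim_row (burau_mat t m u * burau_mat t m v)"
    "c < dim_col (burau_mat t m u * burau_mat t m v)"
  then have "r < m" "c < m" by (simp_all add: burau_mat_def)
  then show "burau_mat t m (u @ v) $$ (r, c) = (burau_mat t m u * burau_mat t m v) $$ (r, c)"
    using matrix_like_foldr_reduced_burau[OF assms, of t, unfolded matrix_like_def,
        rule_format, of r "foldr (reduced_burau t) v (unit_seq c)"]
    by (simp add: burau_mat_def scalar_prod_def atLeast0LessThan mult.commute)
qed (simp_all add: burau_mat_def)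

text \<open>
  The determinant is linear in column \<open>k\<close>; the cofactors along it depend on the other columns only.
\<close>

lemma det_affine_in_column:
  fixes A B C :: "'a :: comm_ring_1 Matrix.mat"
  assumes carr: "A \<in> carrier_mat m m" "B \<in> carrier_mat m m" "C \<in> carrier_mat m m" and k: "k < m"
    and other: "\<And>i j. i < m \<Longrightarrow> j < m \<Longrightarrow> j \<noteq> k \<Longrightarrow> A $$ (i, j) = B $$ (i, j) \<and> A $$ (i, j) = C $$ (i, j)"
    and col: "\<And>i. i < m \<Longrightarrow> A $$ (i, k) = a * B $$ (i, k) + b * C $$ (i, k)"
  shows "Determinant.det A = a * Determinant.det B + b * Determinant.det C"
proof -
  have cof: "cofactor A i k = cofactor B i k" "cofactor A i k = cofactor C i k" if "i < m" for i
  proof -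
    have "mat_delete A i k = mat_delete B i k"
      using carr k that other[THEN conjunct1] by (auto intro!: eq_matI simp: mat_delete_def)
    moreover have "mat_delete A i k = mat_delete C i k"
      using carr k that other[THEN conjunct2] by (auto intro!: eq_matI simp: mat_delete_def)
    ultimately
    show "cofactor A i k = cofactor B i k" "cofactor A i k = cofactor C i k"
      by (simp_all add: cofactor_def)
  qed
  have "Determinant.det A = (\<Sum>i<m. A $$ (i, k) * cofactor A i k)"
    by (rule laplace_expansion_column[OF carr(1) k])
  also have "\<dots> = (\<Sum>i<m. a * (B $$ (i, k) * cofactor B i k) + b * (C $$ (i, k) * cofactor C i k))"
    using col cof by (intro sum.cong) (auto simp: algebra_simps)
  also have "\<dots> = a * Determinant.det B + b * Determinant.det C"
    by (simp add: sum.distrib sum_distrib_left laplace_expansion_column[OF carr(2) k]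
        laplace_expansion_column[OF carr(3) k])
  finally show ?thesis .
qed

lemma det_burau_mat_letter_nonzero:
  assumes "t \<noteq> 0" "i < m"
  shows "Determinant.det (burau_mat t m [i]) \<noteq> 0"
proof -
  let ?S = "burau_mat t m [i]"
  have S: "?S \<in> carrier_mat m m" by simp
  \<comment> \<open>By the quadratic relation the generator has an inverse up to the factor \<open>t\<close>.\<close>
  have "?S * (?S - (1 - t) \<cdot>\<^sub>m 1\<^sub>m m) = burau_mat t m ([i] @ [i]) - (1 - t) \<cdot>\<^sub>m ?S"
    using assms mult_minus_distrib_mat[OF S S, of "(1 - t) \<cdot>\<^sub>m 1\<^sub>m m"]
      mult_smult_distrib[OF S one_carrier_mat, of "1 - t"] right_mult_one_mat[OF S]
    by (subst burau_mat_append) auto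
  also have "\<dots> = t \<cdot>\<^sub>m 1\<^sub>m m"
    by (rule eq_matI) (auto simp: burau_mat_def reduced_burau_quadratic)
  finally have "Determinant.det ?S * Determinant.det (?S - (1 - t) \<cdot>\<^sub>m 1\<^sub>m m) = t ^ m"
    by (subst det_mult[symmetric, of _ m]) auto
  with assms show ?thesis by auto
qed

text \<open>
  Take determinants in \<open>(1 - A B) A = A (1 - B A)\<close>.
\<close>

lemma det_one_minus_mult_commute:
  fixes A B :: "'a :: idom Matrix.mat"
  assumes A: "A \<in> carrier_mat m m" and B: "B \<in> carrier_mat m m" and nz: "Determinant.det A \<noteq> 0"
  shows "Determinant.det (1\<^sub>m m - A * B) = Determinant.det (1\<^sub>m m - B * A)"
proof -
  have AB: "A * B \<in> carrier_mat m m" and BA: "B * A \<in> carrier_mat m m"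
    using A B by simp_all
  have "(1\<^sub>m m - A * B) * A = 1\<^sub>m m * A - A * B * A"
    by (rule minus_mult_distrib_mat[OF one_carrier_mat AB A])
  also have "\<dots> = A * 1\<^sub>m m - A * (B * A)"
    by (simp only: left_mult_one_mat[OF A] right_mult_one_mat[OF A] assoc_mult_mat[OF A B A])
  also have "\<dots> = A * (1\<^sub>m m - B * A)"
    by (rule mult_minus_distrib_mat[OF A one_carrier_mat BA, symmetric])
  finally have "Determinant.det ((1\<^sub>m m - A * B) * A) = Determinant.det (A * (1\<^sub>m m - B * A))"
    by (rule arg_cong)
  then have "Determinant.det (1\<^sub>m m - A * B) * Determinant.det A =
      Determinant.det A * Determinant.det (1\<^sub>m m - B * A)"
    by (simp only: det_mult[OF minus_carrier_mat[OF AB] A] det_mult[OF A minus_carrier_mat[OF BA]])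
  with nz show ?thesis by simp
qed

text \<open>
  The parameter \<open>1 / q\<close> makes the generators scaled by \<open>q\<close> satisfy the Hecke relation; the scaling
  is the factor in front. Up to normalisation, the determinant is the Alexander polynomial of the
  closure of the braid.
\<close>

definition burau_det :: "real \<Rightarrow> nat \<Rightarrow> nat list \<Rightarrow> real" where
  "burau_det q m w = q ^ length w * Determinant.det (1\<^sub>m m - burau_mat (1 / q) m w)"

lemma burau_det_rotate:
  assumes q: "q \<noteq> 0" and i: "i < m" and w: "set w \<subseteq> {..<m}"
  shows "burau_det q m (i # w) = burau_det q m (w @ [i])"
proof -
  let ?A = "burau_mat (1 / q) m [i]" and ?B = "burau_mat (1 / q) m w"
  have "Determinant.det (1\<^sub>m m - ?A * ?B) = Determinant.det (1\<^sub>m m - ?B * ?A)"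
    using q i by (intro det_one_minus_mult_commute burau_mat_carrier det_burau_mat_letter_nonzero) auto
  moreover have "burau_mat (1 / q) m (i # w) = ?A * ?B"
    using burau_mat_append[of "[i]" m "1 / q" w] i by simp
  moreover have "burau_mat (1 / q) m (w @ [i]) = ?B * ?A"
    using w by (rule burau_mat_append)
  ultimately show ?thesis
    by (simp add: burau_det_def)
qed

lemma burau_det_rotate_word:
  assumes q: "q \<noteq> 0" and "set u \<subseteq> {..<m}" "set v \<subseteq> {..<m}"
  shows "burau_det q m (u @ v) = burau_det q m (v @ u)"
  using assms(2,3)
proof (induction u arbitrary: v)
  case (Cons i u)
  have "burau_det q m ((i # u) @ v) = burau_det q m ((u @ v) @ [i])"
    using burau_det_rotate[OF q, of i m "u @ v"] Cons.prems by simp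
  also have "\<dots> = burau_det q m (u @ (v @ [i]))" by simp
  also have "\<dots> = burau_det q m ((v @ [i]) @ u)"
    using Cons.prems by (intro Cons.IH) auto
  finally show ?case by simp
qed simp

text \<open>
  The skein relation. It is enough to have the square at the end of the word, where it acts first;
  rotation moves it anywhere.
\<close>

lemma burau_det_square:
  assumes q: "q \<noteq> 0" and i: "i < m" and w: "set w \<subseteq> {..<m}"
  shows "burau_det q m (w @ [i, i]) = (q - 1) * burau_det q m (w @ [i]) + q * burau_det q m w"
proof -
  let ?t = "1 / q"
  let ?E = "\<lambda>w. 1\<^sub>m m - burau_mat ?t m w"
  \<comment> \<open>All columns but the one with index \<open>i\<close> are the same for the three words.\<close>
  have unit: "reduced_burau ?t i (unit_seq c) = unit_seq c" if "c \<noteq> i" for c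
    using that by (auto simp: reduced_burau_def fun_eq_iff)
  have "Determinant.det (?E (w @ [i, i])) =
      (1 - ?t) * Determinant.det (?E (w @ [i])) + ?t * Determinant.det (?E w)"
  proof (rule det_affine_in_column[where k = i and m = m])
    fix r c assume "r < m" "c < m" "c \<noteq> i"
    then show "?E (w @ [i, i]) $$ (r, c) = ?E (w @ [i]) $$ (r, c) \<and>
        ?E (w @ [i, i]) $$ (r, c) = ?E w $$ (r, c)"
      by (simp add: burau_mat_def unit)
  next
    fix r assume r: "r < m"
    have "foldr (reduced_burau ?t) w y r = (\<Sum>c<m. y c * foldr (reduced_burau ?t) w (unit_seq c) r)" for y
      using matrix_like_foldr_reduced_burau[OF w] r unfolding matrix_like_def by blast
    note L = this[of "reduced_burau ?t i (reduced_burau ?t i (unit_seq i))"]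
      this[of "reduced_burau ?t i (unit_seq i)"] this[of "unit_seq i"]
    have "foldr (reduced_burau ?t) w (reduced_burau ?t i (reduced_burau ?t i (unit_seq i))) r =
       (1 - ?t) * foldr (reduced_burau ?t) w (reduced_burau ?t i (unit_seq i)) r +
       ?t * foldr (reduced_burau ?t) w (unit_seq i) r"
      unfolding L reduced_burau_quadratic
      by (simp only: distrib_right sum.distrib sum_distrib_left mult.assoc)
    then show "?E (w @ [i, i]) $$ (r, i) = (1 - ?t) * ?E (w @ [i]) $$ (r, i) + ?t * ?E w $$ (r, i)"
      using r i by (simp add: burau_mat_def algebra_simps)
  qed (simp_all add: i minus_carrier_mat[OF burau_mat_carrier])
  note step = this
  show ?thesis
    unfolding burau_det_def step using q by (simp add: field_simps)
qed

lemma burau_det_cong: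
  assumes "length u = length v" "foldr (reduced_burau (1 / q)) u = foldr (reduced_burau (1 / q)) v"
  shows "burau_det q m u = burau_det q m v"
  using assms by (simp add: burau_det_def burau_mat_def)

text \<open>
  Only generator \<open>i\<close> moves the unit vector with index \<open>i\<close>, so a word without \<open>i\<close> fixes it and the
  determinant of \<open>1 - \<rho> w\<close> has a zero column.
\<close>

lemma burau_det_missing_letter:
  assumes "i < m" "i \<notin> set w"
  shows "burau_det q m w = 0"
proof -
  have fixed: "foldr (reduced_burau t) w (unit_seq i) = unit_seq i" for t
    using assms(2) by (induction w) (auto simp: reduced_burau_def fun_eq_iff)
  let ?E = "1\<^sub>m m - burau_mat (1 / q) m w"
  have "Determinant.det ?E = (\<Sum>r<m. ?E $$ (r, i) * cofactor ?E r i)"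
    by (rule laplace_expansion_column[OF minus_carrier_mat[OF burau_mat_carrier] assms(1)])
  also have "\<dots> = 0"
    using assms(1) by (intro sum.neutral) (auto simp: burau_mat_def fixed)
  finally show ?thesis by (simp add: burau_det_def)
qed

lemma elliptic_trace_burau_det:
  assumes q: "q \<noteq> 0"
  shows "elliptic_trace q m (\<lambda>w. if set w \<subseteq> {..<m} then burau_det q m w else 0)"
proof -
  let ?f = "\<lambda>w. if set w \<subseteq> {..<m} then burau_det q m w else 0"
  have "hecke_functional q m ?f"
    unfolding hecke_functional_def
  proof (intro conjI allI impI)
    fix u v i assume i: "i < m"
    show "?f (u @ [i, i] @ v) = (q - 1) * ?f (u @ [i] @ v) + q * ?f (u @ v)"
    proof (cases "set u \<subseteq> {..<m} \<and> set v \<subseteq> {..<m}")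
      case True
      then have rot: "set w \<subseteq> {..<m} \<Longrightarrow> burau_det q m (u @ w @ v) = burau_det q m ((v @ u) @ w)" for w
        using burau_det_rotate_word[OF q, of "u @ w" m v] by simp
      have "burau_det q m (u @ v) = burau_det q m (v @ u)"
        using rot[of "[]"] by simp
      then show ?thesis
        using burau_det_square[OF q i, of "v @ u"] rot[of "[i, i]"] rot[of "[i]"] True i by simp
    qed auto
  next
    fix u v i assume "Suc i < m"
    have "burau_det q m (u @ [i, Suc i, i] @ v) = burau_det q m (u @ [Suc i, i, Suc i] @ v)"
      by (rule burau_det_cong) (auto simp: fun_eq_iff reduced_burau_braid)
    then show "?f (u @ [i, Suc i, i] @ v) = ?f (u @ [Suc i, i, Suc i] @ v)"
      by simp
  next
    fix u v i j assume "Suc i < j" "j < m"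
    then have "burau_det q m (u @ [i, j] @ v) = burau_det q m (u @ [j, i] @ v)"
      by (intro burau_det_cong) (auto simp: fun_eq_iff reduced_burau_commute[of i j])
    then show "?f (u @ [i, j] @ v) = ?f (u @ [j, i] @ v)"
      by simp
  qed
  moreover have "?f (i # w) = ?f (w @ [i])" if "i < m" "set w \<subseteq> {..<m}" for i w
    using burau_det_rotate[OF q that] by simp
  moreover have "?f w = 0" if "i < m" "i \<notin> set w" for i w
    using burau_det_missing_letter[OF that] by simp
  ultimately show ?thesis
    unfolding elliptic_trace_def by blast
qed

section \<open>The Burau determinant of the Coxeter element and of the full twist\<close>

text \<open>
  The linear form that all unreduced generators on the first \<open>k\<close> coordinates leave invariant.
\<close>

definition geometric_functional :: "real \<Rightarrow> nat \<Rightarrow> (nat \<Rightarrow> real) \<Rightarrow> real" where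
  "geometric_functional t k x = (1 - t) * (\<Sum>j<k. t ^ j * x j)"

lemma geometric_functional_Suc:
  "geometric_functional t (Suc k) x = geometric_functional t k x + (1 - t) * t ^ k * x k"
  by (simp add: geometric_functional_def algebra_simps)

lemma geometric_functional_cong:
  "(\<And>j. j < k \<Longrightarrow> x j = y j) \<Longrightarrow> geometric_functional t k x = geometric_functional t k y"
  by (simp add: geometric_functional_def)

lemma geometric_functional_unreduced_burau:
  "Suc i < k \<Longrightarrow> geometric_functional t k (unreduced_burau t i x) = geometric_functional t k x"
proof (induction k)
  case (Suc k)
  show ?case
  proof (cases "Suc i = k")
    case True
    have "geometric_functional t i (unreduced_burau t i x) = geometric_functional t i x"
      by (rule geometric_functional_cong) (simp add: unreduced_burau_simps)
    then show ?thesis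
      by (simp add: True[symmetric] geometric_functional_Suc unreduced_burau_simps algebra_simps)
  next
    case False
    then show ?thesis
      using Suc by (simp add: geometric_functional_Suc unreduced_burau_simps)
  qed
qed simp

text \<open>
  In the product of generators along \<open>[0..<k]\<close> the entry at \<open>k\<close> is carried to the front, mixing with
  every entry that it passes.
\<close>

lemma foldr_unreduced_burau_ascending:
  "foldr (unreduced_burau t) [0..<k] x =
     (\<lambda>j. if j = 0 then geometric_functional t k x + t ^ k * x k else if j \<le> k then x (j - 1) else x j)"
proof (induction k arbitrary: x)
  case 0
  then show ?case by (auto simp: geometric_functional_def)
next
  case (Suc k)
  have "geometric_functional t k (unreduced_burau t k x) = geometric_functional t k x"
    by (rule geometric_functional_cong) (simp add: unreduced_burau_simps)
  then have "foldr (unreduced_burau t) [0..<k] (unreduced_burau t k x) j =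
      (if j = 0 then geometric_functional t (Suc k) x + t ^ Suc k * x (Suc k)
       else if j \<le> Suc k then x (j - 1) else x j)" for j
    unfolding Suc by (auto simp: geometric_functional_Suc unreduced_burau_simps algebra_simps le_Suc_eq)
  then show ?case by (simp add: fun_eq_iff)
qed

lemma foldr_unreduced_burau_descending:
  "foldr (unreduced_burau t) (rev [0..<k]) x =
     (\<lambda>j. if j < k then (1 - t) * x 0 + t * x (Suc j) else if j = k then x 0 else x j)"
proof (induction k)
  case (Suc k)
  show ?case
  proof
    fix j
    show "foldr (unreduced_burau t) (rev [0..<Suc k]) x j =
        (if j < Suc k then (1 - t) * x 0 + t * x (Suc j) else if j = Suc k then x 0 else x j)"
      by (cases "j = k"; cases "j = Suc k") (simp_all add: Suc unreduced_burau_simps)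
  qed
qed (simp add: fun_eq_iff)

lemma foldr_unreduced_burau_loop:
  "foldr (unreduced_burau t) (rev [0..<k] @ [0..<k]) x =
     (\<lambda>j. if j < k then (1 - t) * (geometric_functional t k x + t ^ k * x k) + t * x j
          else if j = k then geometric_functional t k x + t ^ k * x k else x j)"
  by (auto simp: foldr_unreduced_burau_ascending foldr_unreduced_burau_descending fun_eq_iff)

text \<open>
  The loop carries the entry at \<open>k\<close> around all entries before it. It is a Jucys-Murphy element, and
  therefore commutes with the generators that only involve those entries.
\<close>

lemma foldr_unreduced_burau_loop_commute:
  assumes "\<forall>i\<in>set w. Suc i < k"
  shows "foldr (unreduced_burau t) (rev [0..<k] @ [0..<k]) (foldr (unreduced_burau t) w x) =
         foldr (unreduced_burau t) w (foldr (unreduced_burau t) (rev [0..<k] @ [0..<k]) x)"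
  using assms
proof (induction w)
  case (Cons i w)
  let ?J = "foldr (unreduced_burau t) (rev [0..<k] @ [0..<k])"
  have "Suc i < k" using Cons.prems by simp
  have "?J (unreduced_burau t i y) = unreduced_burau t i (?J y)" for y
  proof
    fix j
    show "?J (unreduced_burau t i y) j = unreduced_burau t i (?J y) j"
      unfolding foldr_unreduced_burau_loop
        geometric_functional_unreduced_burau[OF \<open>Suc i < k\<close>]
      using \<open>Suc i < k\<close>
      by (cases "j = i"; cases "j = Suc i") (simp_all add: unreduced_burau_simps algebra_simps)
  qed
  moreover have "?J (foldr (unreduced_burau t) w x) = foldr (unreduced_burau t) w (?J x)"
    using Cons by simp
  ultimately show ?case by (simp only: foldr_Cons comp_def)
qed simp

text \<open>
  A reduced word of the longest permutation of \<open>k + 1\<close> points.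
\<close>

primrec half_twist :: "nat \<Rightarrow> nat list" where
  "half_twist 0 = []"
| "half_twist (Suc k) = half_twist k @ rev [0..<Suc k]"

lemma set_half_twist: "set (half_twist k) \<subseteq> {..<k}"
  by (induction k) auto

lemma length_half_twist: "2 * length (half_twist k) = k * Suc k"
  by (induction k) auto

text \<open>
  The full twist on \<open>k + 2\<close> points is the full twist on \<open>k + 1\<close> points followed by the loop of the
  last point, because the loop commutes with the half twists around it. It is a scalar modulo
  constant sequences, and hence a scalar in the reduced action.
\<close>

lemma foldr_unreduced_burau_full_twist:
  "foldr (unreduced_burau t) (half_twist k @ rev (half_twist k)) x =
     (\<lambda>j. if j \<le> k then t ^ Suc k * x j + geometric_functional t (Suc k) x else x j)"
proof (induction k arbitrary: x)
  case 0
  show ?case by (auto simp: geometric_functional_def algebra_simps fun_eq_iff)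
next
  case (Suc k)
  let ?B = "foldr (unreduced_burau t)"
  let ?J = "rev [0..<Suc k] @ [0..<Suc k]"
  have w: "\<forall>i\<in>set (half_twist k). Suc i < Suc k"
    using set_half_twist[of k] by auto
  have inv: "geometric_functional t (Suc k) (?B w x) = geometric_functional t (Suc k) x"
    if "set w \<subseteq> {..<k}" for w
    using that by (induction w) (auto simp: geometric_functional_unreduced_burau)
  have "?B (half_twist (Suc k) @ rev (half_twist (Suc k))) x =
      ?B (half_twist k) (?B ?J (?B (rev (half_twist k)) x))"
    by (simp del: upt_Suc)
  also have "\<dots> = ?B ?J (?B (half_twist k @ rev (half_twist k)) x)"
    unfolding foldr_append[of _ "half_twist k"] comp_def
    by (rule foldr_unreduced_burau_loop_commute[OF w, symmetric])
  also have "\<dots> = (\<lambda>j. if j \<le> Suc k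
      then t ^ Suc (Suc k) * x j + geometric_functional t (Suc (Suc k)) x else x j)"
  proof -
    define z where "z = ?B (half_twist k @ rev (half_twist k)) x"
    have z: "z = (\<lambda>j. if j \<le> k then t ^ Suc k * x j + geometric_functional t (Suc k) x else x j)"
      unfolding z_def by (rule Suc.IH)
    have "geometric_functional t (Suc k) z = geometric_functional t (Suc k) x"
      unfolding z_def using set_half_twist[of k] by (intro inv) auto
    moreover have "z (Suc k) = x (Suc k)" by (simp add: z)
    ultimately have P: "geometric_functional t (Suc k) z + t ^ Suc k * z (Suc k) =
        geometric_functional t (Suc k) x + t ^ Suc k * x (Suc k)"
      by simp
    show ?thesis
    proof
      fix j
      consider "j \<le> k" | "j = Suc k" | "Suc k < j" by linarith
      then show "?B ?J (?B (half_twist k @ rev (half_twist k)) x) j = (if j \<le> Suc k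
          then t ^ Suc (Suc k) * x j + geometric_functional t (Suc (Suc k)) x else x j)"
      proof cases
        case 1
        then have "z j = t ^ Suc k * x j + geometric_functional t (Suc k) x" by (simp add: z)
        with 1 show ?thesis
          unfolding z_def[symmetric] foldr_unreduced_burau_loop P
          by (simp add: geometric_functional_Suc[of t "Suc k"] algebra_simps)
      next
        case 2
        then show ?thesis
          unfolding z_def[symmetric] foldr_unreduced_burau_loop P
          by (simp add: geometric_functional_Suc[of t "Suc k"] algebra_simps)
      next
        case 3
        then have "z j = x j" by (simp add: z)
        with 3 show ?thesis
          unfolding z_def[symmetric] foldr_unreduced_burau_loop by simp
      qed
    qed
  qed
  finally show ?case .
qed

lemma foldr_reduced_burau_full_twist:
  assumes "j < k"
  shows "foldr (reduced_burau t) (half_twist k @ rev (half_twist k)) y j = t ^ Suc k * y j"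
proof -
  obtain x where y: "y = differences x"
    using surj_differences by (metis surjD)
  show ?thesis
    unfolding y differences_foldr_unreduced_burau[symmetric] foldr_unreduced_burau_full_twist
    using assms by (simp add: differences_def algebra_simps)
qed

lemma burau_det_full_twist:
  assumes q: "q \<noteq> 0"
  shows "burau_det q m (half_twist m @ rev (half_twist m)) = (q ^ Suc m - 1) ^ m"
proof -
  let ?w = "half_twist m @ rev (half_twist m)"
  have "1\<^sub>m m - burau_mat (1 / q) m ?w = (1 - (1 / q) ^ Suc m) \<cdot>\<^sub>m 1\<^sub>m m"
    by (rule eq_matI) (auto simp: burau_mat_def foldr_reduced_burau_full_twist simp del: foldr_append)
  moreover have "length ?w = Suc m * m"
    using length_half_twist[of m] by simp
  ultimately have "burau_det q m ?w = (q ^ Suc m) ^ m * (1 - (1 / q) ^ Suc m) ^ m"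
    by (simp only: burau_det_def det_smult det_one power_mult) simp
  also have "\<dots> = (q ^ Suc m * (1 - (1 / q) ^ Suc m)) ^ m"
    by (simp only: power_mult_distrib)
  also have "q ^ Suc m * (1 - (1 / q) ^ Suc m) = q ^ Suc m - 1"
    using q by (simp add: power_divide right_diff_distrib)
  finally show ?thesis .
qed

lemma foldr_reduced_burau_coxeter:
  assumes "j < m"
  shows "foldr (reduced_burau t) [0..<m] y j =
     (if j = 0 then - (\<Sum>l<m. t ^ Suc l * y l) else y (j - 1))"
proof -
  obtain x where y: "y = differences x"
    using surj_differences by (metis surjD)
  have "geometric_functional t m x + t ^ m * x m - x 0 = - (\<Sum>l<m. t ^ Suc l * differences x l)"
    by (induction m) (simp_all add: geometric_functional_Suc differences_def algebra_simps,
       simp add: geometric_functional_def)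
  then show ?thesis
    unfolding y differences_foldr_unreduced_burau[symmetric] foldr_unreduced_burau_ascending
    using assms by (auto simp: differences_def)
qed

text \<open>
  With \<open>t = 1 / q\<close>, the Coxeter word acts by a companion matrix with characteristic polynomial
  \<open>X\<^bsup>m\<^esup> + t X\<^bsup>m-1\<^esup> + \<dots> + t\<^bsup>m\<^esup>\<close>, and the determinant is the value of this polynomial at \<open>1\<close>.
\<close>

lemma burau_det_coxeter:
  assumes q: "q \<noteq> 0"
  shows "burau_det q m [0..<m] = (\<Sum>l\<le>m. q ^ l)"
proof -
  define t where "t = 1 / q"
  define E where "E = 1\<^sub>m m - burau_mat t m [0..<m]"
  \<comment> \<open>Multiplication by \<open>P\<close> replaces each column of \<open>E\<close> by the sum of the columns from it onwards. This
    clears the entries \<open>- 1\<close> below the diagonal and collects the first row in the corner.\<close>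
  define P where "P = Matrix.mat m m (\<lambda>(r, c). if c \<le> r then 1 else (0::real))"
  have E: "E \<in> carrier_mat m m" and P: "P \<in> carrier_mat m m"
    by (simp_all add: E_def P_def minus_carrier_mat[OF burau_mat_carrier])
  have t1: "(\<Sum>l<m. t * t ^ l * unit_seq c l) = t * t ^ c" if "c < m" for c
  proof -
    have "(\<Sum>l<m. t * t ^ l * unit_seq c l) = (\<Sum>l<m. if c = l then t * t ^ l else 0)"
      by (rule sum.cong) auto
    then show ?thesis using that by simp
  qed
  have E_entry: "E $$ (r, c) = (if r = c then 1 else 0) +
      (if r = 0 then t ^ Suc c else if r = Suc c then - 1 else 0)" if "r < m" "c < m" for r c
    using that unfolding E_def by (auto simp: burau_mat_def foldr_reduced_burau_coxeter t1)
  have EP_row: "(E * P) $$ (r, c) = (if r = c then 1 else 0)" if "0 < r" "r < m" "c < m" for r c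
  proof -
    have "(E * P) $$ (r, c) = (\<Sum>k<m. E $$ (r, k) * P $$ (k, c))"
      using that E P by (simp add: scalar_prod_def atLeast0LessThan)
    also have "\<dots> = (\<Sum>k<m. (if r = k then P $$ (k, c) else 0) - (if r - 1 = k then P $$ (k, c) else 0))"
      using that by (intro sum.cong) (auto simp: E_entry)
    also have "\<dots> = P $$ (r, c) - P $$ (r - 1, c)"
      using that by (simp add: sum_subtractf)
    also have "\<dots> = (if r = c then 1 else 0)"
      using that by (auto simp: P_def)
    finally show ?thesis .
  qed
  have EP_corner: "(E * P) $$ (0, 0) = (\<Sum>l\<le>m. t ^ l)" if "0 < m"
  proof -
    have "(E * P) $$ (0, 0) = (\<Sum>k<m. (if 0 = k then 1 else 0) + t ^ Suc k)"
      using that E P by (simp add: scalar_prod_def atLeast0LessThan E_entry P_def)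
    also have "\<dots> = 1 + (\<Sum>k<m. t ^ Suc k)"
      using that by (simp add: sum.distrib)
    also have "\<dots> = (\<Sum>l<Suc m. t ^ l)"
      by (simp only: sum.lessThan_Suc_shift power_0)
    also have "\<dots> = (\<Sum>l\<le>m. t ^ l)"
      by (simp only: lessThan_Suc_atMost)
    finally show ?thesis .
  qed
  have "prod_list (diag_mat P) = 1"
  proof -
    have "diag_mat P = map (\<lambda>i. 1) [0..<m]"
      unfolding diag_mat_def P_def by (intro map_cong) auto
    then show ?thesis by (simp add: map_replicate_const)
  qed
  moreover have "Determinant.det P = prod_list (diag_mat P)"
    by (rule det_lower_triangular[OF _ P]) (simp add: P_def)
  ultimately have "Determinant.det E = Determinant.det (E * P)"
    using det_mult[OF E P] by simp
  also have "\<dots> = prod_list (diag_mat (E * P))"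
    using E P EP_row by (intro det_upper_triangular[of _ m]) auto
  also have "\<dots> = (\<Sum>l\<le>m. t ^ l)"
  proof (cases m)
    case 0
    then show ?thesis using E P by (simp add: diag_mat_def)
  next
    case (Suc m')
    have "diag_mat (E * P) = map (\<lambda>i. (E * P) $$ (i, i)) [0..<m]"
      using E P by (simp add: diag_mat_def)
    also have "\<dots> = (E * P) $$ (0, 0) # map (\<lambda>i. (E * P) $$ (i, i)) [1..<m]"
      by (simp add: Suc upt_rec[of 0] del: upt_Suc)
    also have "map (\<lambda>i. (E * P) $$ (i, i)) [1..<m] = map (\<lambda>i. 1) [1..<m]"
      using EP_row by (intro map_cong) auto
    finally show ?thesis
      using EP_corner Suc by (simp del: upt_Suc add: map_replicate_const)
  qed
  finally have "burau_det q m [0..<m] = (\<Sum>l\<le>m. q ^ m * t ^ l)"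
    by (simp add: burau_det_def E_def t_def sum_distrib_left)
  also have "\<dots> = (\<Sum>l\<le>m. q ^ (m - l))"
    using q by (intro sum.cong) (auto simp: t_def power_diff power_divide)
  also have "\<dots> = (\<Sum>l\<le>m. q ^ l)"
    by (rule sum.nat_diff_reindex[of _ "Suc m", simplified lessThan_Suc_atMost, simplified])
  finally show ?thesis .
qed

text \<open>
  Every elliptic trace with the right value on the Coxeter word is the Burau determinant, and the
  latter is known on the full twist.
\<close>

lemma elliptic_trace_full_twist:
  assumes q: "q \<noteq> 0" and f: "elliptic_trace q m f" and cox: "f [0..<m] = (\<Sum>l\<le>m. q ^ l)"
  shows "f (half_twist m @ rev (half_twist m)) = (q ^ Suc m - 1) ^ m"
proof -
  let ?w = "half_twist m @ rev (half_twist m)"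
  have w: "set ?w \<subseteq> {..<m}"
    using set_half_twist[of m] by simp
  have "f [0..<m] = (if set [0..<m] \<subseteq> {..<m} then burau_det q m [0..<m] else 0)"
    using cox by (simp add: burau_det_coxeter[OF q] atLeast0LessThan)
  from elliptic_trace_unique[OF f elliptic_trace_burau_det[OF q] this w]
  show ?thesis
    using burau_det_full_twist[OF q, of m] w by simp
qed

section \<open>Subspaces and flags over a finite field\<close>

text \<open>
  The coordinates with respect to a basis range freely over the field.
\<close>

lemma card_subspace:
  fixes S :: "('a::{field,finite}^'n) set"
  assumes S: "vec.subspace S"
  shows "card S = CARD('a) ^ vec.dim S"
proof -
  obtain B where B: "B \<subseteq> S" "vec.independent B" "S \<subseteq> vec.span B" "card B = vec.dim S"
    using vec.basis_exists[of S] by blast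
  have fin: "finite B" using vec.finiteI_independent B(2) by blast
  have span: "vec.span B = S"
    using B S by (intro vec.span_subspace)
  let ?L = "\<lambda>u. \<Sum>b\<in>B. u b *s b"
  have "bij_betw ?L (B \<rightarrow>\<^sub>E UNIV) S"
    unfolding bij_betw_def
  proof
    show "inj_on ?L (B \<rightarrow>\<^sub>E UNIV)"
    proof (rule inj_onI)
      fix u w assume u: "u \<in> B \<rightarrow>\<^sub>E UNIV" and w: "w \<in> B \<rightarrow>\<^sub>E UNIV" and eq: "?L u = ?L w"
      have "(\<Sum>b\<in>B. (u b - w b) *s b) = 0"
        using eq by (simp add: vec.scale_left_diff_distrib sum_subtractf)
      then have "u b = w b" if "b \<in> B" for b
        using vec.independentD[OF B(2) fin order_refl _ that, of "\<lambda>b. u b - w b"] by simp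
      then show "u = w" using u w by (intro PiE_ext)
    qed
    show "?L ` (B \<rightarrow>\<^sub>E UNIV) = S"
    proof
      show "?L ` (B \<rightarrow>\<^sub>E UNIV) \<subseteq> S"
        using span vec.span_finite[OF fin] by auto
      show "S \<subseteq> ?L ` (B \<rightarrow>\<^sub>E UNIV)"
      proof
        fix s assume "s \<in> S"
        then obtain u where "s = ?L u"
          using span vec.span_finite[OF fin] by auto
        then have "s = ?L (restrict u B)" by simp
        then show "s \<in> ?L ` (B \<rightarrow>\<^sub>E UNIV)"
          by (rule image_eqI[where x = "restrict u B"]) simp
      qed
    qed
  qed
  then have "card (B \<rightarrow>\<^sub>E (UNIV :: 'a set)) = card S"
    by (rule bij_betw_same_card)
  then show ?thesis using fin B(4) by (simp add: card_PiE)
qed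

lemma span_id:
  fixes S :: "('a::field^'n) set"
  shows "vec.subspace S \<Longrightarrow> vec.span S = S"
  by simp

lemma dim_plus_dim_le:
  fixes S T U :: "('a::field^'n) set"
  assumes "vec.subspace S" "vec.subspace T" "S \<subseteq> U" "T \<subseteq> U" "vec.subspace U"
  shows "vec.dim S + vec.dim T \<le> vec.dim U + vec.dim (S \<inter> T)"
proof -
  have "{x + y |x y. x \<in> S \<and> y \<in> T} \<subseteq> U"
    using assms vec.subspace_add by blast
  then have "vec.dim {x + y |x y. x \<in> S \<and> y \<in> T} \<le> vec.dim U"
    by (rule vec.dim_subset)
  with vec.dim_sums_Int[OF assms(1,2)] show ?thesis by linarith
qed

lemma dim_zero_iff:
  fixes S :: "('a::field^'n) set"
  assumes "vec.subspace S"
  shows "vec.dim S = 0 \<longleftrightarrow> S = {0}"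
  using vec.subspace_0[OF assms] by (auto simp: vec.dim_eq_0)

lemma dim_eq_CARD_iff:
  fixes S :: "('a::field^'n) set"
  assumes "vec.subspace S"
  shows "vec.dim S = CARD('n) \<longleftrightarrow> S = UNIV"
  using vec.dim_eq_full[of S] span_id[OF assms] by (simp add: vec.dimension_def card_cart_basis)

lemma dim_le_CARD: "vec.dim (S :: ('a::field^'n) set) \<le> CARD('n)"
  using vec.dim_subset_UNIV[of S] by (simp add: vec.dimension_def card_cart_basis)

text \<open>
  Lines in the quotient \<open>B / A\<close>, counted as the nonzero vectors up to scalars. The case \<open>d = 2\<close> gives
  the \<open>q + 1\<close> flags in a panel, and \<open>A = 0\<close> the lines in a vector space.
\<close>

lemma card_one_step_extensions:
  fixes A B :: "('a::{field,finite}^'n) set"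
  assumes A: "vec.subspace A" and B: "vec.subspace B" and AB: "A \<subseteq> B" and dim: "vec.dim B = vec.dim A + d"
  shows "card {W. vec.subspace W \<and> A \<subseteq> W \<and> W \<subseteq> B \<and> vec.dim W = Suc (vec.dim A)} = (\<Sum>l<d. CARD('a) ^ l)"
proof -
  let ?q = "CARD('a)" and ?a = "vec.dim A"
  let ?E = "{W. vec.subspace W \<and> A \<subseteq> W \<and> W \<subseteq> B \<and> vec.dim W = Suc (vec.dim A)}"
  have q: "?q > 1"
    using card_mono[of "UNIV :: 'a set" "{0, 1}"] by simp
  have ext: "W = vec.span (insert v A)" if "W \<in> ?E" "v \<in> W - A" for W v
  proof -
    have "vec.dim (vec.span (insert v A)) = Suc ?a"
      using that by (simp add: vec.dim_insert span_id[OF A])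
    moreover have "vec.span (insert v A) \<subseteq> W"
      using that by (intro vec.span_minimal) auto
    ultimately show ?thesis
      using that by (intro vec.subspace_dim_equal[symmetric]) auto
  qed
  \<comment> \<open>Each vector of \<open>B\<close> outside \<open>A\<close> lies in exactly one extension, its span with \<open>A\<close>.\<close>
  have union: "(\<Union>W\<in>?E. W - A) = B - A"
  proof
    show "B - A \<subseteq> (\<Union>W\<in>?E. W - A)"
    proof
      fix v assume v: "v \<in> B - A"
      have "vec.dim (vec.span (insert v A)) = Suc ?a"
        using v by (simp add: vec.dim_insert span_id[OF A])
      moreover have "vec.span (insert v A) \<subseteq> B"
        using v AB B by (intro vec.span_minimal) auto
      moreover have "insert v A \<subseteq> vec.span (insert v A)"
        by (rule vec.span_superset)
      ultimately have "vec.span (insert v A) \<in> ?E" "v \<in> vec.span (insert v A) - A"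
        using v by auto
      then show "v \<in> (\<Union>W\<in>?E. W - A)" by blast
    qed
  qed auto
  have "card (B - A) = (\<Sum>W\<in>?E. card (W - A))"
    unfolding union[symmetric]
  proof (rule card_UN_disjoint)
    show "\<forall>W\<in>?E. \<forall>W'\<in>?E. W \<noteq> W' \<longrightarrow> (W - A) \<inter> (W' - A) = {}"
      using ext by (metis (no_types, lifting) Int_iff equals0I)
  qed simp_all
  moreover have "card (W - A) = ?q ^ ?a * (?q - 1)" if "W \<in> ?E" for W
    using that A by (simp add: card_Diff_subset card_subspace algebra_simps)
  moreover have "card (B - A) = ?q ^ ?a * (?q ^ d - 1)"
    using A B AB dim by (simp add: card_Diff_subset card_subspace algebra_simps power_add)
  ultimately have "?q ^ ?a * (?q ^ d - 1) = card ?E * (?q ^ ?a * (?q - 1))"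
    by simp
  then have "?q ^ d - 1 = card ?E * (?q - 1)"
    using q by (metis (no_types, lifting) mult.left_commute mult_left_cancel power_not_zero not_one_less_zero)
  moreover have "?q ^ d - 1 = (\<Sum>l<d. ?q ^ l) * (?q - 1)"
  proof -
    have "int (?q ^ d) - 1 = (int ?q - 1) * (\<Sum>l<d. int ?q ^ l)"
      using power_diff_1_eq[of "int ?q" d] by simp
    then have "int (?q ^ d - 1) = int ((\<Sum>l<d. ?q ^ l) * (?q - 1))"
      using q by (simp add: of_nat_diff mult.commute)
    then show ?thesis by (simp only: of_nat_eq_iff)
  qed
  ultimately show ?thesis using q by simp
qed

text \<open>
  The flag is continued by the whole space beyond the dimension, so that flags are determined as
  functions and neighbours need no case distinction at the ends.
\<close>

definition complete_flag :: "(nat \<Rightarrow> ('a::field^'n) set) \<Rightarrow> bool" where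
  "complete_flag x \<longleftrightarrow>
     (\<forall>k. vec.subspace (x k) \<and> vec.dim (x k) = min k CARD('n) \<and> x k \<subseteq> x (Suc k))"

lemma complete_flagD:
  fixes x :: "nat \<Rightarrow> ('a::field^'n) set"
  assumes "complete_flag x"
  shows "vec.subspace (x k)" "k \<le> CARD('n) \<Longrightarrow> vec.dim (x k) = k" "x k \<subseteq> x (Suc k)"
    "j \<le> k \<Longrightarrow> x j \<subseteq> x k" "x 0 = {0}" "CARD('n) \<le> k \<Longrightarrow> x k = UNIV" "0 \<in> x k"
proof -
  have sub: "vec.subspace (x k)" for k
    using assms unfolding complete_flag_def by auto
  then show "vec.subspace (x k)" .
  have step: "x k \<subseteq> x (Suc k)" for k
    using assms unfolding complete_flag_def by auto
  then show "x k \<subseteq> x (Suc k)" .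
  show "k \<le> CARD('n) \<Longrightarrow> vec.dim (x k) = k"
    using assms unfolding complete_flag_def by auto
  show "j \<le> k \<Longrightarrow> x j \<subseteq> x k"
    by (rule lift_Suc_mono_le[of x, OF step])
  show "x 0 = {0}"
    using assms dim_zero_iff[of "x 0"] unfolding complete_flag_def by simp
  show "CARD('n) \<le> k \<Longrightarrow> x k = UNIV"
    using assms dim_eq_CARD_iff[of "x k"] unfolding complete_flag_def by (simp add: min_def split: if_splits)
  show "0 \<in> x k" using sub by (rule vec.subspace_0)
qed

lemma finite_complete_flags: "finite {x :: nat \<Rightarrow> ('a::{field,finite}^'n) set. complete_flag x}"
proof (rule finite_subset)
  show "{x :: nat \<Rightarrow> ('a^'n) set. complete_flag x} \<subseteq>
      {x. \<forall>k. (k \<in> {..<CARD('n)} \<longrightarrow> x k \<in> UNIV) \<and> (k \<notin> {..<CARD('n)} \<longrightarrow> x k = UNIV)}"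
    using complete_flagD(6) by (auto simp: not_less)
  show "finite {x :: nat \<Rightarrow> ('a^'n) set.
      \<forall>k. (k \<in> {..<CARD('n)} \<longrightarrow> x k \<in> UNIV) \<and> (k \<notin> {..<CARD('n)} \<longrightarrow> x k = UNIV)}"
    by (rule finite_set_of_finite_funs) auto
qed

lemma complete_flag_upd:
  fixes x :: "nat \<Rightarrow> ('a::field^'n) set"
  assumes x: "complete_flag x" and i: "Suc i \<le> CARD('n)"
    and W: "vec.subspace W" "vec.dim W = Suc i" "x i \<subseteq> W" "W \<subseteq> x (Suc (Suc i))"
  shows "complete_flag (x(Suc i := W))"
  unfolding complete_flag_def
proof
  fix k
  show "vec.subspace ((x(Suc i := W)) k) \<and> vec.dim ((x(Suc i := W)) k) = min k CARD('n) \<and>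
      (x(Suc i := W)) k \<subseteq> (x(Suc i := W)) (Suc k)"
    using x W i unfolding complete_flag_def by auto
qed

text \<open>
  Letters count from \<open>0\<close>, whereas the first subspace that can vary has index \<open>1\<close>; so letter \<open>i\<close>
  changes the member of dimension \<open>Suc i\<close>.
\<close>

definition adjacent :: "nat \<Rightarrow> (nat \<Rightarrow> 'v set) \<Rightarrow> (nat \<Rightarrow> 'v set) \<Rightarrow> bool" where
  "adjacent i x y \<longleftrightarrow> x (Suc i) \<noteq> y (Suc i) \<and> (\<forall>k. k \<noteq> Suc i \<longrightarrow> x k = y k)"

lemma card_panel:
  fixes x :: "nat \<Rightarrow> ('a::{field,finite}^'n) set"
  assumes x: "complete_flag x" and i: "Suc (Suc i) \<le> CARD('n)"
  shows "card {z. complete_flag z \<and> (\<forall>k. k \<noteq> Suc i \<longrightarrow> z k = x k)} = CARD('a) + 1"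
proof -
  note X = complete_flagD[OF x]
  let ?E = "{W. vec.subspace W \<and> x i \<subseteq> W \<and> W \<subseteq> x (Suc (Suc i)) \<and> vec.dim W = Suc (vec.dim (x i))}"
  have dim: "vec.dim (x i) = i" "vec.dim (x (Suc (Suc i))) = Suc (Suc i)"
    using X(2) i by auto
  have "bij_betw (\<lambda>W. x(Suc i := W)) ?E {z. complete_flag z \<and> (\<forall>k. k \<noteq> Suc i \<longrightarrow> z k = x k)}"
  proof (rule bij_betwI[where g = "\<lambda>z. z (Suc i)"])
    show "(\<lambda>W. x(Suc i := W)) \<in> ?E \<rightarrow> {z. complete_flag z \<and> (\<forall>k. k \<noteq> Suc i \<longrightarrow> z k = x k)}"
      using complete_flag_upd[OF x, of i] i dim by auto
    show "(\<lambda>z. z (Suc i)) \<in> {z. complete_flag z \<and> (\<forall>k. k \<noteq> Suc i \<longrightarrow> z k = x k)} \<rightarrow> ?E"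
    proof (rule funcsetI)
      fix z assume "z \<in> {z. complete_flag z \<and> (\<forall>k. k \<noteq> Suc i \<longrightarrow> z k = x k)}"
      then have z: "complete_flag z" and eq: "\<forall>k. k \<noteq> Suc i \<longrightarrow> z k = x k"
        by blast+
      have "z i = x i" "z (Suc (Suc i)) = x (Suc (Suc i))" using eq by auto
      then show "z (Suc i) \<in> ?E"
        using complete_flagD(1-3)[OF z, of "Suc i"] complete_flagD(3)[OF z, of i] i dim by auto
    qed
  qed (auto simp: fun_eq_iff)
  then have "card {z. complete_flag z \<and> (\<forall>k. k \<noteq> Suc i \<longrightarrow> z k = x k)} = card ?E"
    by (rule bij_betw_same_card[symmetric])
  also have "\<dots> = (\<Sum>l<2. CARD('a) ^ l)"
    using X(1) X(4)[of i "Suc (Suc i)"] dim by (intro card_one_step_extensions) auto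
  finally show ?thesis by (simp add: numeral_2_eq_2)
qed

section \<open>Counting galleries of flags\<close>

abbreviation flags :: "(nat \<Rightarrow> ('a::field^'n) set) set" where
  "flags \<equiv> Collect complete_flag"

text \<open>
  Matrix entries of the Hecke algebra acting on functions on flags. They are real numbers because
  they are compared with determinants.
\<close>

primrec gallery_count ::
  "nat list \<Rightarrow> (nat \<Rightarrow> ('a::{field,finite}^'n) set) \<Rightarrow> (nat \<Rightarrow> ('a^'n) set) \<Rightarrow> real" where
  "gallery_count [] x y = of_bool (x = y)"
| "gallery_count (i # w) x y = (\<Sum>z\<in>flags. of_bool (adjacent i x z) * gallery_count w z y)"

text \<open>
  In the sums over an intermediate flag below, the flag is determined by its neighbours whenever it
  exists. Such a sum is the truth value of a condition on the two ends.
\<close>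

lemma sum_of_bool_unique:
  assumes "finite A" "\<And>z. z \<in> A \<Longrightarrow> P z \<longleftrightarrow> C \<and> z = c" "C \<Longrightarrow> c \<in> A"
  shows "(\<Sum>z\<in>A. of_bool (P z)) = (of_bool C :: real)"
proof -
  have "(\<Sum>z\<in>A. of_bool (P z)) = (\<Sum>z\<in>A. if z = c then of_bool C else (0::real))"
    using assms(2) by (intro sum.cong refl) auto
  then show ?thesis using assms(1,3) by auto
qed

lemma gallery_count_append:
  fixes x y :: "nat \<Rightarrow> ('a::{field,finite}^'n) set"
  assumes "complete_flag x"
  shows "gallery_count (u @ v) x y = (\<Sum>z\<in>flags. gallery_count u x z * gallery_count v z y)"
  using assms
proof (induction u arbitrary: x)
  case Nil
  have "(\<Sum>z\<in>flags. of_bool (x = z) * gallery_count v z y) =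
      (\<Sum>z\<in>flags. if x = z then gallery_count v z y else 0)"
    by (intro sum.cong refl) auto
  then show ?case using Nil by (simp add: sum.delta'[OF finite_complete_flags])
next
  case (Cons i u)
  have "gallery_count ((i # u) @ v) x y =
      (\<Sum>t\<in>flags. of_bool (adjacent i x t) * (\<Sum>z\<in>flags. gallery_count u t z * gallery_count v z y))"
    using Cons.IH by simp
  also have "\<dots> = (\<Sum>t\<in>flags. \<Sum>z\<in>flags. of_bool (adjacent i x t) * gallery_count u t z * gallery_count v z y)"
    by (simp only: sum_distrib_left mult.assoc)
  also have "\<dots> = (\<Sum>z\<in>flags. \<Sum>t\<in>flags. of_bool (adjacent i x t) * gallery_count u t z * gallery_count v z y)"
    by (rule sum.swap)
  also have "\<dots> = (\<Sum>z\<in>flags. gallery_count (i # u) x z * gallery_count v z y)"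
    by (simp only: gallery_count.simps sum_distrib_right)
  finally show ?case .
qed

lemma gallery_count_single:
  fixes x y :: "nat \<Rightarrow> ('a::{field,finite}^'n) set"
  assumes "complete_flag y"
  shows "gallery_count [i] x y = of_bool (adjacent i x y)"
proof -
  have "gallery_count [i] x y = (\<Sum>z\<in>flags. if z = y then of_bool (adjacent i x y) else 0)"
    unfolding gallery_count.simps by (intro sum.cong refl) auto
  then show ?thesis using assms by (simp add: sum.delta[OF finite_complete_flags])
qed

lemma gallery_count_context:
  fixes x y :: "nat \<Rightarrow> ('a::{field,finite}^'n) set"
  assumes x: "complete_flag x"
  shows "gallery_count (a @ u @ b) x y =
    (\<Sum>z\<in>flags. \<Sum>w\<in>flags. gallery_count a x z * (gallery_count u z w * gallery_count b w y))"
proof -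
  have "gallery_count (a @ u @ b) x y = (\<Sum>z\<in>flags. gallery_count a x z * gallery_count (u @ b) z y)"
    by (rule gallery_count_append[OF x])
  also have "\<dots> = (\<Sum>z\<in>flags. gallery_count a x z * (\<Sum>w\<in>flags. gallery_count u z w * gallery_count b w y))"
    using gallery_count_append[of _ u b y] by (intro sum.cong refl) simp
  also have "\<dots> = (\<Sum>z\<in>flags. \<Sum>w\<in>flags. gallery_count a x z * (gallery_count u z w * gallery_count b w y))"
    by (simp only: sum_distrib_left)
  finally show ?thesis .
qed

lemma gallery_count_replace:
  fixes x y :: "nat \<Rightarrow> ('a::{field,finite}^'n) set"
  assumes "\<And>z w :: nat \<Rightarrow> ('a^'n) set. complete_flag z \<Longrightarrow> complete_flag w \<Longrightarrow> gallery_count u z w = gallery_count u' z w"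
    and x: "complete_flag x"
  shows "gallery_count (a @ u @ b) x y = gallery_count (a @ u' @ b) x y"
  unfolding gallery_count_context[OF x]
  using assms(1) by (intro sum.cong refl) simp

lemma adjacent_iff:
  "adjacent i x y \<longleftrightarrow> x \<noteq> y \<and> (\<forall>k. k \<noteq> Suc i \<longrightarrow> y k = x k)"
proof -
  have "x = y" if "x (Suc i) = y (Suc i)" "\<forall>k. k \<noteq> Suc i \<longrightarrow> y k = x k"
  proof
    fix k show "x k = y k" using that by (cases "k = Suc i") simp_all
  qed
  then show ?thesis unfolding adjacent_def by metis
qed

text \<open>
  The intermediate flag ranges over the \<open>q + 1\<close> flags of the panel of \<open>x\<close>, except \<open>x\<close> and \<open>y\<close>.
\<close>

lemma gallery_count_square:
  fixes x y :: "nat \<Rightarrow> ('a::{field,finite}^'n) set"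
  assumes x: "complete_flag x" and y: "complete_flag y" and i: "Suc (Suc i) \<le> CARD('n)"
  shows "gallery_count [i, i] x y =
    (real CARD('a) - 1) * gallery_count [i] x y + real CARD('a) * gallery_count [] x y"
proof -
  let ?P = "{z. complete_flag z \<and> (\<forall>k. k \<noteq> Suc i \<longrightarrow> z k = x k)}"
  have fin: "finite ?P"
    by (rule finite_subset[OF _ finite_complete_flags]) auto
  have "gallery_count [i, i] x y = (\<Sum>z\<in>flags. of_bool (adjacent i x z) * of_bool (adjacent i z y))"
    using gallery_count_single[OF y, of i] by (simp only: gallery_count.simps(2)[of i "[i]"])
  also have "\<dots> = (\<Sum>z\<in>flags. of_bool (adjacent i x z \<and> adjacent i z y))"
    by (intro sum.cong refl) auto
  also have "\<dots> = real (card {z \<in> flags. adjacent i x z \<and> adjacent i z y})"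
    using sum_of_bool_eq[of flags "\<lambda>z. adjacent i x z \<and> adjacent i z y", where ?'a = real]
    by (simp only: finite_complete_flags Int_def mem_Collect_eq simp_thms)
  also have "{z \<in> flags. adjacent i x z \<and> adjacent i z y} = (if y \<in> ?P then ?P - {x, y} else {})"
  proof (cases "y \<in> ?P")
    case True
    then have y_eq: "\<And>k. k \<noteq> Suc i \<Longrightarrow> y k = x k" by simp
    have "(\<forall>k. k \<noteq> Suc i \<longrightarrow> y k = z k) \<longleftrightarrow> (\<forall>k. k \<noteq> Suc i \<longrightarrow> z k = x k)" for z
      using y_eq by metis
    then have "adjacent i x z \<and> adjacent i z y \<longleftrightarrow> z \<noteq> x \<and> z \<noteq> y \<and> (\<forall>k. k \<noteq> Suc i \<longrightarrow> z k = x k)" for z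
      by (simp only: adjacent_iff) blast
    with True show ?thesis by auto
  next
    case False
    then obtain k where k: "k \<noteq> Suc i" "y k \<noteq> x k" using y by blast
    have "\<not> (adjacent i x z \<and> adjacent i z y)" for z
      using k unfolding adjacent_def by metis
    then have "{z \<in> flags. adjacent i x z \<and> adjacent i z y} = {}" by blast
    then show ?thesis unfolding if_not_P[OF False] .
  qed
  also have "real (card \<dots>) = of_bool (y \<in> ?P) * (real CARD('a) + 1 - real (card {x, y}))"
  proof (cases "y \<in> ?P")
    case True
    have "{x, y} \<subseteq> ?P" using x True by auto
    then have "card (?P - {x, y}) = card ?P - card {x, y}" "card {x, y} \<le> card ?P"
      using fin by (auto intro: card_Diff_subset card_mono)
    then show ?thesis
      using True card_panel[OF x i] by (simp add: of_nat_diff)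
  next
    case False
    show ?thesis unfolding of_bool_def if_not_P[OF False] by simp
  qed
  also have "\<dots> = (real CARD('a) - 1) * of_bool (adjacent i x y) + real CARD('a) * of_bool (x = y)"
  proof (cases "x = y")
    case True
    then show ?thesis using x by (simp add: adjacent_def)
  next
    case False
    moreover have "adjacent i x y \<longleftrightarrow> y \<in> ?P"
      using False y by (simp add: adjacent_iff)
    ultimately show ?thesis by simp
  qed
  finally show ?thesis
    using gallery_count_single[OF y, of i] by simp
qed

lemma gallery_count_two_letters:
  fixes x y :: "nat \<Rightarrow> ('a::{field,finite}^'n) set"
  assumes x: "complete_flag x" and y: "complete_flag y" and "i \<noteq> j"
  shows "gallery_count [i, j] x y =
    of_bool ((\<forall>k. k \<noteq> Suc i \<longrightarrow> k \<noteq> Suc j \<longrightarrow> x k = y k) \<and> x (Suc i) \<noteq> y (Suc i) \<and>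
      x (Suc j) \<noteq> y (Suc j) \<and> complete_flag (x(Suc i := y (Suc i))))"
proof -
  have "gallery_count [i, j] x y = (\<Sum>z\<in>flags. of_bool (adjacent i x z) * of_bool (adjacent j z y))"
    using gallery_count_single[OF y, of j] by (simp only: gallery_count.simps(2)[of i "[j]"])
  also have "\<dots> = (\<Sum>z\<in>flags. of_bool (adjacent i x z \<and> adjacent j z y))"
    by (intro sum.cong refl) auto
  also have "\<dots> = of_bool ((\<forall>k. k \<noteq> Suc i \<longrightarrow> k \<noteq> Suc j \<longrightarrow> x k = y k) \<and> x (Suc i) \<noteq> y (Suc i) \<and>
      x (Suc j) \<noteq> y (Suc j) \<and> complete_flag (x(Suc i := y (Suc i))))"
  proof (rule sum_of_bool_unique[OF finite_complete_flags, where c = "x(Suc i := y (Suc i))"])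
    fix z :: "nat \<Rightarrow> ('a^'n) set" assume z: "z \<in> flags"
    show "adjacent i x z \<and> adjacent j z y \<longleftrightarrow>
      ((\<forall>k. k \<noteq> Suc i \<longrightarrow> k \<noteq> Suc j \<longrightarrow> x k = y k) \<and> x (Suc i) \<noteq> y (Suc i) \<and>
      x (Suc j) \<noteq> y (Suc j) \<and> complete_flag (x(Suc i := y (Suc i)))) \<and> z = x(Suc i := y (Suc i))"
      (is "?L \<longleftrightarrow> ?C \<and> _")
    proof
      assume L: ?L
      then have "z = x(Suc i := y (Suc i))"
        using \<open>i \<noteq> j\<close> by (auto simp: adjacent_def fun_eq_iff)
      with L z \<open>i \<noteq> j\<close> show "?C \<and> z = x(Suc i := y (Suc i))"
        by (auto simp: adjacent_def)
    next
      assume "?C \<and> z = x(Suc i := y (Suc i))"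
      then show ?L using \<open>i \<noteq> j\<close> by (auto simp: adjacent_def)
    qed
  qed auto
  finally show ?thesis .
qed

lemma gallery_count_commute:
  fixes x y :: "nat \<Rightarrow> ('a::{field,finite}^'n) set"
  assumes x: "complete_flag x" and y: "complete_flag y" and ij: "Suc i < j" and j: "Suc (Suc j) \<le> CARD('n)"
  shows "gallery_count [i, j] x y = gallery_count [j, i] x y"
proof -
  let ?agree = "\<forall>k. k \<noteq> Suc i \<longrightarrow> k \<noteq> Suc j \<longrightarrow> x k = y k"
  have "complete_flag (x(Suc l := y (Suc l)))"
    if "\<forall>k. k \<noteq> Suc i \<longrightarrow> k \<noteq> Suc j \<longrightarrow> x k = y k" "l = i \<or> l = j" for l
  proof (rule complete_flag_upd[OF x])
    show "Suc l \<le> CARD('n)" using that ij j by auto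
    then show "vec.dim (y (Suc l)) = Suc l" by (rule complete_flagD(2)[OF y])
    show "vec.subspace (y (Suc l))" by (rule complete_flagD(1)[OF y])
    have "x l = y l" "x (Suc (Suc l)) = y (Suc (Suc l))"
      using that ij by auto
    then show "x l \<subseteq> y (Suc l)" "y (Suc l) \<subseteq> x (Suc (Suc l))"
      using complete_flagD(3)[OF y] by auto
  qed
  from this[of i] this[of j]
  have upd: "?agree \<Longrightarrow> complete_flag (x(Suc i := y (Suc i)))"
    "?agree \<Longrightarrow> complete_flag (x(Suc j := y (Suc j)))"
    by simp_all
  have swap: "(\<forall>k. k \<noteq> Suc j \<longrightarrow> k \<noteq> Suc i \<longrightarrow> x k = y k) \<longleftrightarrow> ?agree"
    by iprover
  have "i \<noteq> j" using ij by simp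
  show ?thesis
    unfolding gallery_count_two_letters[OF x y \<open>i \<noteq> j\<close>]
      gallery_count_two_letters[OF x y \<open>i \<noteq> j\<close>[symmetric]] swap
    using upd by (intro arg_cong[where f = of_bool]) argo
qed

text \<open>
  The first letter is kept as a sum over \<open>z\<close>, while the two others are evaluated. Then \<open>z\<close> differs
  from \<open>x\<close>, and its new member also fits into \<open>y\<close>. In this form the two sides of the braid relation
  can be treated alike.
\<close>

lemma gallery_count_three_letters:
  fixes x y :: "nat \<Rightarrow> ('a::{field,finite}^'n) set"
  assumes x: "complete_flag x" and y: "complete_flag y" and "i \<noteq> j"
  shows "gallery_count [i, j, i] x y =
    (\<Sum>z\<in>flags. of_bool (adjacent i x z \<and> (\<forall>k. k \<noteq> Suc i \<longrightarrow> k \<noteq> Suc j \<longrightarrow> x k = y k) \<and>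
      z (Suc i) \<noteq> y (Suc i) \<and> x (Suc j) \<noteq> y (Suc j) \<and> complete_flag (y(Suc i := z (Suc i)))))"
proof -
  have "of_bool (adjacent i x z) * gallery_count [j, i] z y =
      of_bool (adjacent i x z \<and> (\<forall>k. k \<noteq> Suc i \<longrightarrow> k \<noteq> Suc j \<longrightarrow> x k = y k) \<and>
      z (Suc i) \<noteq> y (Suc i) \<and> x (Suc j) \<noteq> y (Suc j) \<and> complete_flag (y(Suc i := z (Suc i))))"
    if z: "complete_flag z" for z
  proof (cases "adjacent i x z")
    case True
    then have zx: "z k = x k" if "k \<noteq> Suc i" for k
      using that by (simp add: adjacent_def)
    let ?agree = "\<forall>k. k \<noteq> Suc i \<longrightarrow> k \<noteq> Suc j \<longrightarrow> x k = y k"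
    have upd: "z(Suc j := y (Suc j)) = y(Suc i := z (Suc i))" if ?agree
    proof
      fix k
      show "(z(Suc j := y (Suc j))) k = (y(Suc i := z (Suc i))) k"
        using that zx \<open>i \<noteq> j\<close> by (cases "k = Suc i"; cases "k = Suc j") simp_all
    qed
    have agree: "(\<forall>k. k \<noteq> Suc j \<longrightarrow> k \<noteq> Suc i \<longrightarrow> z k = y k) \<longleftrightarrow> ?agree"
      using zx by metis
    have zj: "z (Suc j) = x (Suc j)" using zx \<open>i \<noteq> j\<close> by simp
    have "gallery_count [j, i] z y = of_bool (?agree \<and> z (Suc i) \<noteq> y (Suc i) \<and>
        x (Suc j) \<noteq> y (Suc j) \<and> complete_flag (y(Suc i := z (Suc i))))"
      unfolding gallery_count_two_letters[OF z y \<open>i \<noteq> j\<close>[symmetric]] agree zj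
      using upd by (intro arg_cong[where f = of_bool]) metis
    with True show ?thesis by simp
  next
    case False
    then show ?thesis by simp
  qed
  then show ?thesis
    unfolding gallery_count.simps(2)[of i "[j, i]"] by (intro sum.cong refl) simp
qed

text \<open>
  Modulo the common subspace of dimension \<open>i\<close> this happens in a projective plane: \<open>x\<close> and \<open>y\<close> are
  flags consisting of a point and a line. The galleries on the left exchange the point first and must
  pass through the common point of the two lines, those on the right use the line joining the two
  points. Both exist exactly if neither point lies on the other line.
\<close>

lemma gallery_count_braid:
  fixes x y :: "nat \<Rightarrow> ('a::{field,finite}^'n) set"
  assumes x: "complete_flag x" and y: "complete_flag y" and i: "Suc (Suc (Suc i)) \<le> CARD('n)"
  shows "gallery_count [i, Suc i, i] x y = gallery_count [Suc i, i, Suc i] x y"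
proof -
  note X = complete_flagD[OF x] and Y = complete_flagD[OF y]
  let ?p = "x (Suc i)" and ?l = "x (Suc (Suc i))" and ?p' = "y (Suc i)" and ?l' = "y (Suc (Suc i))"
  let ?agree = "\<forall>k. k \<noteq> Suc i \<longrightarrow> k \<noteq> Suc (Suc i) \<longrightarrow> x k = y k"
  let ?C = "?agree \<and> \<not> ?p \<subseteq> ?l' \<and> \<not> ?p' \<subseteq> ?l"
  \<comment> \<open>Points \<open>?p\<close>, \<open>?p'\<close> on lines \<open>?l\<close>, \<open>?l'\<close>; \<open>?m\<close> is where the lines meet and \<open>?s\<close> joins the
    points.\<close>
  let ?m = "?l \<inter> ?l'" and ?s = "{a + b |a b. a \<in> ?p \<and> b \<in> ?p'}"
  have dims: "vec.dim ?p = Suc i" "vec.dim ?p' = Suc i"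
    "vec.dim ?l = Suc (Suc i)" "vec.dim ?l' = Suc (Suc i)"
    using X(2) Y(2) i by auto
  have sub_m: "vec.subspace ?m" using X(1) Y(1) by (simp add: vec.subspace_inter)
  have sub_s: "vec.subspace ?s" using X(1) Y(1) by (intro vec.subspace_sums)
  have p_s: "?p \<subseteq> ?s" "?p' \<subseteq> ?s"
    using X(7) Y(7) by force+
  have s_least: "?s \<subseteq> U" if "?p \<subseteq> U" "?p' \<subseteq> U" "vec.subspace U" for U
    using that vec.subspace_add by blast
  have dim_m_le: "vec.dim ?m \<le> Suc i" if "?l \<noteq> ?l'"
  proof (rule ccontr)
    assume "\<not> vec.dim ?m \<le> Suc i"
    then have "?m = ?l" "?m = ?l'"
      using sub_m X(1) Y(1) dims by (intro vec.subspace_dim_equal; simp)+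
    with that show False by simp
  qed
  have dim_m: "vec.dim ?m = Suc i" if "?agree" "?l \<noteq> ?l'"
  proof -
    have "?l' \<subseteq> x (Suc (Suc (Suc i)))"
      using Y(3)[of "Suc (Suc i)"] that(1) by simp
    then have "vec.dim ?l + vec.dim ?l' \<le> vec.dim (x (Suc (Suc (Suc i)))) + vec.dim ?m"
      by (intro dim_plus_dim_le X(1) Y(1) X(3))
    then show ?thesis using dim_m_le[OF that(2)] dims X(2)[of "Suc (Suc (Suc i))"] i by simp
  qed
  have dim_s_ge: "Suc (Suc i) \<le> vec.dim ?s" if "?p \<noteq> ?p'"
  proof (rule ccontr)
    assume "\<not> Suc (Suc i) \<le> vec.dim ?s"
    then have "?p = ?s" "?p' = ?s"
      using sub_s X(1) Y(1) dims p_s by (intro vec.subspace_dim_equal; simp)+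
    with that show False by simp
  qed
  have dim_s: "vec.dim ?s = Suc (Suc i)" if "?agree" "?p \<noteq> ?p'"
  proof -
    have "x i \<subseteq> ?p \<inter> ?p'"
      using X(3)[of i] Y(3)[of i] that(1) by simp
    then have "i \<le> vec.dim (?p \<inter> ?p')"
      using vec.dim_subset[of "x i" "?p \<inter> ?p'"] X(2)[of i] i by simp
    then show ?thesis
      using vec.dim_sums_Int[OF X(1) Y(1), of "Suc i" "Suc i"] dim_s_ge[OF that(2)] dims by simp
  qed
  have "gallery_count [i, Suc i, i] x y = of_bool ?C"
    unfolding gallery_count_three_letters[OF x y n_not_Suc_n]
  proof (rule sum_of_bool_unique[OF finite_complete_flags, where c = "x(Suc i := ?m)"])
    fix z :: "nat \<Rightarrow> ('a^'n) set" assume "z \<in> flags"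
    then have z: "complete_flag z" by simp
    show "(adjacent i x z \<and> ?agree \<and> z (Suc i) \<noteq> ?p' \<and> ?l \<noteq> ?l' \<and> complete_flag (y(Suc i := z (Suc i))))
       \<longleftrightarrow> ?C \<and> z = x(Suc i := ?m)" (is "?L \<longleftrightarrow> _")
    proof
      assume L: ?L
      then have zx: "\<And>k. k \<noteq> Suc i \<Longrightarrow> z k = x k" and "z (Suc i) \<noteq> ?p" and agree: ?agree
        by (auto simp: adjacent_def)
      have "z (Suc i) \<subseteq> ?l"
        using complete_flagD(3)[OF z, of "Suc i"] zx by simp
      moreover have "z (Suc i) \<subseteq> ?l'"
        using complete_flagD(3)[of "y(Suc i := z (Suc i))" "Suc i"] L by simp
      ultimately have zm: "z (Suc i) = ?m"
        using L dim_m_le sub_m complete_flagD(1,2)[OF z, of "Suc i"] i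
        by (intro vec.subspace_dim_equal) auto
      have "\<not> ?p \<subseteq> ?l'"
      proof
        assume "?p \<subseteq> ?l'"
        then have "?p = ?m"
          using X(3)[of "Suc i"] dim_m_le L dims sub_m X(1) by (intro vec.subspace_dim_equal) auto
        with zm \<open>z (Suc i) \<noteq> ?p\<close> show False by simp
      qed
      moreover have "\<not> ?p' \<subseteq> ?l"
      proof
        assume "?p' \<subseteq> ?l"
        then have "?p' = ?m"
          using Y(3)[of "Suc i"] dim_m_le L dims sub_m Y(1) by (intro vec.subspace_dim_equal) auto
        with zm L show False by simp
      qed
      moreover have "z = x(Suc i := ?m)"
      proof
        fix k show "z k = (x(Suc i := ?m)) k" using zx zm by (cases "k = Suc i") simp_all
      qed
      ultimately show "?C \<and> z = x(Suc i := ?m)" using agree by argo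
    next
      assume R: "?C \<and> z = x(Suc i := ?m)"
      then have agree: ?agree and C: "\<not> ?p \<subseteq> ?l'" "\<not> ?p' \<subseteq> ?l" and zeq: "z = x(Suc i := ?m)"
        by argo+
      have ll: "?l \<noteq> ?l'" using C X(3)[of "Suc i"] by auto
      have pm: "?m \<noteq> ?p" "?m \<noteq> ?p'" using C by auto
      have "complete_flag (y(Suc i := ?m))"
      proof (rule complete_flag_upd[OF y])
        have "y i = x i" using agree by simp
        then show "y i \<subseteq> ?m" using X(4)[of i "Suc (Suc i)"] Y(4)[of i "Suc (Suc i)"] by simp
      qed (use dim_m[OF agree ll] sub_m i in auto)
      moreover have "adjacent i x z"
        using pm(1) zeq by (auto simp: adjacent_def)
      moreover have "z (Suc i) = ?m" using zeq by simp
      ultimately show ?L using agree ll pm(2) by simp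
    qed
  next
    assume C: ?C
    then have ll: "?l \<noteq> ?l'" using X(3)[of "Suc i"] by auto
    have "complete_flag (x(Suc i := ?m))"
    proof (rule complete_flag_upd[OF x])
      have "y i = x i" using C by simp
      then show "x i \<subseteq> ?m" using X(4)[of i "Suc (Suc i)"] Y(4)[of i "Suc (Suc i)"] by simp
    qed (use dim_m[OF _ ll] C sub_m i in auto)
    then show "x(Suc i := ?m) \<in> flags" by simp
  qed
  moreover have "gallery_count [Suc i, i, Suc i] x y = of_bool ?C"
    unfolding gallery_count_three_letters[OF x y n_not_Suc_n[symmetric]]
  proof (rule sum_of_bool_unique[OF finite_complete_flags, where c = "x(Suc (Suc i) := ?s)"])
    fix z :: "nat \<Rightarrow> ('a^'n) set" assume "z \<in> flags"
    then have z: "complete_flag z" by simp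
    have swap: "(\<forall>k. k \<noteq> Suc (Suc i) \<longrightarrow> k \<noteq> Suc i \<longrightarrow> x k = y k) \<longleftrightarrow> ?agree"
      by iprover
    show "(adjacent (Suc i) x z \<and> (\<forall>k. k \<noteq> Suc (Suc i) \<longrightarrow> k \<noteq> Suc i \<longrightarrow> x k = y k) \<and>
        z (Suc (Suc i)) \<noteq> ?l' \<and> ?p \<noteq> ?p' \<and> complete_flag (y(Suc (Suc i) := z (Suc (Suc i)))))
       \<longleftrightarrow> ?C \<and> z = x(Suc (Suc i) := ?s)" (is "?L \<longleftrightarrow> _")
    proof
      assume L: ?L
      then have zx: "\<And>k. k \<noteq> Suc (Suc i) \<Longrightarrow> z k = x k" and zl: "z (Suc (Suc i)) \<noteq> ?l" and agree: ?agree
        by (auto simp: adjacent_def)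
      have "?p \<subseteq> z (Suc (Suc i))"
        using complete_flagD(3)[OF z, of "Suc i"] zx by simp
      moreover have "?p' \<subseteq> z (Suc (Suc i))"
        using complete_flagD(3)[of "y(Suc (Suc i) := z (Suc (Suc i)))" "Suc i"] L by simp
      ultimately have "?s \<subseteq> z (Suc (Suc i))"
        using complete_flagD(1)[OF z] vec.subspace_add by blast
      then have zs: "?s = z (Suc (Suc i))"
        using L dim_s_ge sub_s complete_flagD(1,2)[OF z, of "Suc (Suc i)"] i
        by (intro vec.subspace_dim_equal) auto
      have "\<not> ?p \<subseteq> ?l'"
      proof
        assume "?p \<subseteq> ?l'"
        then have "?s \<subseteq> ?l'"
          using Y(3)[of "Suc i"] Y(1) vec.subspace_add by blast
        then have "?s = ?l'"
          using dim_s_ge L dims sub_s Y(1) by (intro vec.subspace_dim_equal) auto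
        with zs L show False by simp
      qed
      moreover have "\<not> ?p' \<subseteq> ?l"
      proof
        assume "?p' \<subseteq> ?l"
        then have "?s \<subseteq> ?l"
          using X(3)[of "Suc i"] X(1) vec.subspace_add by blast
        then have "?s = ?l"
          using dim_s_ge L dims sub_s X(1) by (intro vec.subspace_dim_equal) auto
        with zs zl show False by simp
      qed
      moreover have "z = x(Suc (Suc i) := ?s)"
      proof
        fix k show "z k = (x(Suc (Suc i) := ?s)) k" using zx zs by (cases "k = Suc (Suc i)") simp_all
      qed
      ultimately show "?C \<and> z = x(Suc (Suc i) := ?s)" using agree by argo
    next
      assume R: "?C \<and> z = x(Suc (Suc i) := ?s)"
      then have agree: ?agree and C: "\<not> ?p \<subseteq> ?l'" "\<not> ?p' \<subseteq> ?l" and zeq: "z = x(Suc (Suc i) := ?s)"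
        by argo+
      have pp: "?p \<noteq> ?p'" using C X(3)[of "Suc i"] by auto
      have sl: "?s \<noteq> ?l" "?s \<noteq> ?l'" using C p_s by auto
      have "complete_flag (y(Suc (Suc i) := ?s))"
      proof (rule complete_flag_upd[OF y])
        have "x (Suc (Suc (Suc i))) = y (Suc (Suc (Suc i)))" using agree by simp
        then show "?s \<subseteq> y (Suc (Suc (Suc i)))"
          using X(4)[of "Suc i" "Suc (Suc (Suc i))"] Y(4)[of "Suc i" "Suc (Suc (Suc i))"] Y(1)
          by (intro s_least) simp_all
      qed (use dim_s[OF agree pp] sub_s p_s i in auto)
      moreover have "adjacent (Suc i) x z"
        using sl(1) zeq by (auto simp: adjacent_def)
      moreover have "z (Suc (Suc i)) = ?s" using zeq by simp
      ultimately show ?L using agree pp sl(2) by simp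
    qed
  next
    assume C: ?C
    then have pp: "?p \<noteq> ?p'" using X(3)[of "Suc i"] by auto
    have "complete_flag (x(Suc (Suc i) := ?s))"
    proof (rule complete_flag_upd[OF x])
      have "x (Suc (Suc (Suc i))) = y (Suc (Suc (Suc i)))" using C by simp
      then show "?s \<subseteq> x (Suc (Suc (Suc i)))"
        using X(4)[of "Suc i" "Suc (Suc (Suc i))"] Y(4)[of "Suc i" "Suc (Suc (Suc i))"] Y(1)
        by (intro s_least) simp_all
    qed (use dim_s[OF _ pp] C sub_s p_s i in auto)
    then show "x(Suc (Suc i) := ?s) \<in> flags" by simp
  qed
  ultimately show ?thesis by simp
qed

definition flag_image :: "'a::field^'n^'n \<Rightarrow> (nat \<Rightarrow> ('a^'n) set) \<Rightarrow> nat \<Rightarrow> ('a^'n) set" where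
  "flag_image g x = (\<lambda>k. (*v) g ` x k)"

lemma inj_invertible:
  fixes g :: "'a::field^'n^'n"
  shows "invertible g \<Longrightarrow> inj ((*v) g)"
  using invertible_left_inverse matrix_left_invertible_injective by blast

lemma flag_image_inj:
  assumes "invertible g"
  shows "flag_image g x = flag_image g y \<longleftrightarrow> x = y" "flag_image g x k = flag_image g y k \<longleftrightarrow> x k = y k"
  using inj_image_eq_iff[OF inj_invertible[OF assms]] by (simp_all add: flag_image_def fun_eq_iff)

lemma complete_flag_image:
  fixes g :: "'a::field^'n^'n"
  assumes g: "invertible g" and x: "complete_flag x"
  shows "complete_flag (flag_image g x)"
  unfolding complete_flag_def
proof
  fix k
  have "vec.dim ((*v) g ` x k) = vec.dim (x k)"
    by (rule vec.dim_image_eq[OF matrix_vector_mul_linear_gen inj_on_subset[OF inj_invertible[OF g] subset_UNIV]])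
  then show "vec.subspace (flag_image g x k) \<and> vec.dim (flag_image g x k) = min k CARD('n) \<and>
      flag_image g x k \<subseteq> flag_image g x (Suc k)"
    using x unfolding flag_image_def complete_flag_def
    by (auto intro!: vec.subspace_image)
qed

lemma bij_betw_flag_image:
  fixes g :: "'a::{field,finite}^'n^'n"
  assumes g: "invertible g"
  shows "bij_betw (flag_image g) flags flags"
proof -
  have "inj_on (flag_image g) flags"
    using flag_image_inj(1)[OF g] by (intro inj_onI) simp
  moreover have "flag_image g ` flags \<subseteq> flags"
    using complete_flag_image[OF g] by auto
  ultimately show ?thesis
    using endo_inj_surj[OF finite_complete_flags] by (simp add: bij_betw_def)
qed

lemma adjacent_flag_image:
  "invertible g \<Longrightarrow> adjacent i (flag_image g x) (flag_image g y) \<longleftrightarrow> adjacent i x y"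
  unfolding adjacent_def by (simp add: flag_image_inj(2))

lemma gallery_count_flag_image:
  fixes g :: "'a::{field,finite}^'n^'n"
  assumes g: "invertible g"
  shows "gallery_count w (flag_image g x) (flag_image g y) = gallery_count w x y"
proof (induction w arbitrary: x)
  case Nil
  show ?case by (simp add: flag_image_inj(1)[OF g])
next
  case (Cons i w)
  have "gallery_count (i # w) (flag_image g x) (flag_image g y) =
      (\<Sum>z\<in>flags. of_bool (adjacent i (flag_image g x) (flag_image g z)) *
        gallery_count w (flag_image g z) (flag_image g y))"
    unfolding gallery_count.simps by (rule sum.reindex_bij_betw[OF bij_betw_flag_image[OF g], symmetric])
  then show ?case by (simp add: Cons.IH adjacent_flag_image[OF g])
qed

lemma adjacent_commute: "adjacent i x y \<longleftrightarrow> adjacent i y x"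
  unfolding adjacent_def by metis

lemma gallery_count_rev:
  fixes x y :: "nat \<Rightarrow> ('a::{field,finite}^'n) set"
  assumes x: "complete_flag x" and y: "complete_flag y"
  shows "gallery_count (rev w) y x = gallery_count w x y"
  using x
proof (induction w arbitrary: x)
  case (Cons i w)
  have "gallery_count (rev (i # w)) y x = (\<Sum>z\<in>flags. gallery_count (rev w) y z * gallery_count [i] z x)"
    by (simp only: rev.simps gallery_count_append[OF y])
  also have "\<dots> = (\<Sum>z\<in>flags. of_bool (adjacent i x z) * gallery_count w z y)"
    using Cons.IH gallery_count_single[OF Cons.prems, of i] adjacent_commute[of i _ x]
    by (intro sum.cong refl) (simp only: mem_Collect_eq mult.commute)
  finally show ?case by simp
qed (simp add: eq_commute)

text \<open>
  A gallery without the letter \<open>i\<close> never changes the subspace of dimension \<open>i + 1\<close>.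
\<close>

lemma gallery_count_missing_letter:
  assumes "i \<notin> set w" "gallery_count w x y \<noteq> 0"
  shows "x (Suc i) = y (Suc i)"
  using assms
proof (induction w arbitrary: x)
  case (Cons j w)
  obtain z where "adjacent j x z" "gallery_count w z y \<noteq> 0"
  proof (rule ccontr)
    assume "\<not> thesis"
    with that have "of_bool (adjacent j x z) * gallery_count w z y = 0" for z
      by auto
    then have "gallery_count (j # w) x y = 0" by (simp add: sum.neutral)
    with Cons.prems show False by simp
  qed
  with Cons show ?case by (auto simp: adjacent_def)
qed (auto split: if_splits)

text \<open>
  Such a gallery replaces the members from the top downwards, so each new member \<open>y (Suc j)\<close> must
  contain the old member \<open>x j\<close> below it. The intermediate flags are put together from \<open>x\<close> and \<open>y\<close>.
\<close>

lemma gallery_count_descending: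
  fixes x y :: "nat \<Rightarrow> ('a::{field,finite}^'n) set"
  assumes x: "complete_flag x" and y: "complete_flag y" and k: "Suc k \<le> CARD('n)"
  shows "gallery_count (rev [0..<k]) x y =
    of_bool ((\<forall>j<k. x j \<subseteq> y (Suc j) \<and> x (Suc j) \<noteq> y (Suc j)) \<and> (\<forall>j>k. x j = y j))"
  using x k
proof (induction k arbitrary: x)
  case 0
  have "x = y \<longleftrightarrow> (\<forall>j>0. x j = y j)"
  proof
    assume eq: "\<forall>j>0. x j = y j"
    show "x = y"
    proof
      fix j show "x j = y j"
        using eq complete_flagD(5)[OF \<open>complete_flag x\<close>] complete_flagD(5)[OF y] by (cases j) simp_all
    qed
  qed simp
  then show ?case by simp
next
  case (Suc k)
  note x = \<open>complete_flag x\<close>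
  let ?D = "\<lambda>k x. (\<forall>j<k. x j \<subseteq> y (Suc j) \<and> x (Suc j) \<noteq> y (Suc j)) \<and> (\<forall>j>k. x j = y j)"
  have "gallery_count (rev [0..<Suc k]) x y = (\<Sum>z\<in>flags. of_bool (adjacent k x z \<and> ?D k z))"
  proof -
    have "gallery_count (rev [0..<k]) z y = of_bool (?D k z)" if "z \<in> flags" for z
      using Suc.IH[of z] that Suc.prems by simp
    then have "(\<Sum>z\<in>flags. of_bool (adjacent k x z) * gallery_count (rev [0..<k]) z y) =
        (\<Sum>z\<in>flags. of_bool (adjacent k x z \<and> ?D k z))"
      by (intro sum.cong refl) (simp only: of_bool_conj)
    then show ?thesis by simp
  qed
  also have "\<dots> = of_bool (?D (Suc k) x)"
  proof (rule sum_of_bool_unique[OF finite_complete_flags, where c = "x(Suc k := y (Suc k))"])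
    fix z :: "nat \<Rightarrow> ('a^'n) set" assume "z \<in> flags"
    then have z: "complete_flag z" by simp
    show "adjacent k x z \<and> ?D k z \<longleftrightarrow> ?D (Suc k) x \<and> z = x(Suc k := y (Suc k))" (is "?L \<longleftrightarrow> ?R")
    proof
      assume L: ?L
      then have zx: "\<And>j. j \<noteq> Suc k \<Longrightarrow> z j = x j" and zk: "z (Suc k) = y (Suc k)"
        and xk: "x (Suc k) \<noteq> y (Suc k)"
        by (auto simp: adjacent_def)
      have zeq: "z = x(Suc k := y (Suc k))"
      proof
        fix j show "z j = (x(Suc k := y (Suc k))) j" using zx zk by (cases "j = Suc k") simp_all
      qed
      have "x k \<subseteq> y (Suc k)"
        using complete_flagD(3)[OF z, of k] zx[of k] zk by simp
      moreover have "x j \<subseteq> y (Suc j) \<and> x (Suc j) \<noteq> y (Suc j)" if "j < k" for j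
        using L that zx[of j] zx[of "Suc j"] by auto
      moreover have "x j = y j" if "j > Suc k" for j
        using L that zx[of j] by auto
      ultimately show ?R using xk zeq by (auto simp: less_Suc_eq)
    next
      assume R: ?R
      then have zx: "\<And>j. j \<noteq> Suc k \<Longrightarrow> z j = x j" and zk: "z (Suc k) = y (Suc k)"
        by auto
      have "z j \<subseteq> y (Suc j) \<and> z (Suc j) \<noteq> y (Suc j)" if "j < k" for j
        using R that zx[of j] zx[of "Suc j"] by auto
      moreover have "z j = y j" if "j > k" for j
        using R that zx[of j] zk by (cases "j = Suc k") auto
      moreover have "adjacent k x z"
        using R zx zk by (auto simp: adjacent_def)
      ultimately show ?L by blast
    qed
  next
    assume D: "?D (Suc k) x"
    have "complete_flag (x(Suc k := y (Suc k)))"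
    proof (rule complete_flag_upd[OF x])
      show "Suc k \<le> CARD('n)" using Suc.prems by simp
      then show "vec.dim (y (Suc k)) = Suc k" by (rule complete_flagD(2)[OF y])
      show "vec.subspace (y (Suc k))" by (rule complete_flagD(1)[OF y])
      show "x k \<subseteq> y (Suc k)" using D by simp
      have "x (Suc (Suc k)) = y (Suc (Suc k))" using D by simp
      then show "y (Suc k) \<subseteq> x (Suc (Suc k))" using complete_flagD(3)[OF y, of "Suc k"] by simp
    qed
    then show "x(Suc k := y (Suc k)) \<in> flags" by simp
  qed
  finally show ?case .
qed

section \<open>Galleries of the half twist and opposite flags\<close>

text \<open>
  The geometric meaning of the longest element: inside the member of dimension \<open>k + 1\<close> the two flags
  are opposite, and the gallery between opposite flags of a given reduced type is unique.
\<close>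

lemma gallery_count_half_twist:
  fixes x y :: "nat \<Rightarrow> ('a::{field,finite}^'n) set"
  assumes x: "complete_flag x" and y: "complete_flag y" and k: "Suc k \<le> CARD('n)"
  shows "gallery_count (half_twist k) x y =
    of_bool ((\<forall>j>k. x j = y j) \<and> (\<forall>a\<le>Suc k. x a \<inter> y (Suc k - a) = {0}))"
  using y k
proof (induction k arbitrary: y)
  case 0
  note X = complete_flagD[OF x] and Y = complete_flagD[OF \<open>complete_flag y\<close>]
  have "x = y \<longleftrightarrow> (\<forall>j>0. x j = y j)"
  proof
    assume eq: "\<forall>j>0. x j = y j"
    show "x = y"
    proof
      fix j show "x j = y j"
        using eq X(5) Y(5) by (cases j) simp_all
    qed
  qed simp
  moreover have "\<forall>a\<le>Suc 0. x a \<inter> y (Suc 0 - a) = {0}"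
    using X(5,7) Y(5,7) by (auto simp: le_Suc_eq)
  ultimately show ?case by simp
next
  case (Suc k)
  note y = \<open>complete_flag y\<close>
  note X = complete_flagD[OF x] and Y = complete_flagD[OF y]
  let ?H = "\<lambda>k y. (\<forall>j>k. x j = y j) \<and> (\<forall>a\<le>Suc k. x a \<inter> y (Suc k - a) = {0})"
  let ?D = "\<lambda>z. (\<forall>j<Suc k. z j \<subseteq> y (Suc j) \<and> z (Suc j) \<noteq> y (Suc j)) \<and> (\<forall>j>Suc k. z j = y j)"
  \<comment> \<open>The only flag that can stand between the shorter half twist and the descending word: the flag
    induced by \<open>y\<close> on the hyperplane \<open>x (Suc k)\<close> of \<open>x (Suc (Suc k))\<close>.\<close>
  define c where "c = (\<lambda>j. if j \<le> k then x (Suc k) \<inter> y (Suc j) else x j)"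
  have y1: "y (Suc 0) \<subseteq> y (Suc j)" for j
    using Y(4) by simp
  have y1_nz: "\<not> y (Suc 0) \<subseteq> {0}"
    using Y(2)[of "Suc 0"] vec.dim_subset[of "y (Suc 0)" "{0}"] Suc.prems(2) by auto
  have sub: "vec.subspace (x (Suc k) \<inter> y (Suc j))" for j
    using X(1) Y(1) by (simp add: vec.subspace_inter)
  have dim_le: "vec.dim (x (Suc k) \<inter> y (Suc j)) \<le> j" if "\<not> y (Suc 0) \<subseteq> x (Suc k)" "j \<le> k" for j
  proof (rule ccontr)
    assume "\<not> ?thesis"
    then have "x (Suc k) \<inter> y (Suc j) = y (Suc j)"
      using sub Y(1) Y(2)[of "Suc j"] that(2) Suc.prems(2) by (intro vec.subspace_dim_equal) auto
    then show False using that(1) y1[of j] by blast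
  qed
  have "gallery_count (half_twist (Suc k)) x y =
      (\<Sum>z\<in>flags. gallery_count (half_twist k) x z * gallery_count (rev [0..<Suc k]) z y)"
    by (simp only: half_twist.simps gallery_count_append[OF x])
  also have "\<dots> = (\<Sum>z\<in>flags. of_bool (?H k z \<and> ?D z))"
  proof (intro sum.cong refl)
    fix z :: "nat \<Rightarrow> ('a^'n) set" assume "z \<in> flags"
    then have z: "complete_flag z" by simp
    have "gallery_count (half_twist k) x z = of_bool (?H k z)"
      by (rule Suc.IH[OF z]) (use Suc.prems in simp)
    moreover have "gallery_count (rev [0..<Suc k]) z y = of_bool (?D z)"
      by (rule gallery_count_descending[OF z y Suc.prems(2)])
    ultimately show "gallery_count (half_twist k) x z * gallery_count (rev [0..<Suc k]) z y =
        of_bool (?H k z \<and> ?D z)"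
      by (simp only: of_bool_conj)
  qed
  also have "\<dots> = of_bool (?H (Suc k) y)"
  proof (rule sum_of_bool_unique[OF finite_complete_flags, where c = c])
    fix z :: "nat \<Rightarrow> ('a^'n) set" assume "z \<in> flags"
    then have z: "complete_flag z" by simp
    note Z = complete_flagD[OF z]
    show "?H k z \<and> ?D z \<longleftrightarrow> ?H (Suc k) y \<and> z = c" (is "?L \<longleftrightarrow> ?R")
    proof
      assume L: ?L
      then have zx: "\<And>j. j > k \<Longrightarrow> z j = x j" and zy: "\<And>j. j > Suc k \<Longrightarrow> z j = y j"
        and opp: "\<And>a. a \<le> Suc k \<Longrightarrow> x a \<inter> z (Suc k - a) = {0}"
        and below: "\<And>j. j < Suc k \<Longrightarrow> z j \<subseteq> y (Suc j)" and differ: "\<And>j. j < Suc k \<Longrightarrow> z (Suc j) \<noteq> y (Suc j)"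
        by auto
      \<comment> \<open>If the line of \<open>y\<close> lay in \<open>z (Suc j)\<close> but not in \<open>z j\<close>, both \<open>z (Suc j)\<close> and \<open>y (Suc j)\<close> would
        be the span of \<open>z j\<close> and that line, but they differ.\<close>
      have "\<not> y (Suc 0) \<subseteq> z j" if "j \<le> Suc k" for j
        using that
      proof (induction j)
        case 0
        then show ?case using y1_nz Z(5) by simp
      next
        case (Suc j)
        let ?I = "y (Suc j) \<inter> z (Suc j)"
        show ?case
        proof
          assume y1z: "y (Suc 0) \<subseteq> z (Suc j)"
          have j: "j < Suc k" "Suc j \<le> CARD('n)" "j \<le> CARD('n)"
            using Suc.prems \<open>Suc (Suc k) \<le> CARD('n)\<close> by auto
          have subI: "vec.subspace ?I" using Y(1) Z(1) by (simp add: vec.subspace_inter)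
          have "Suc j \<le> vec.dim ?I"
          proof (rule ccontr)
            assume "\<not> Suc j \<le> vec.dim ?I"
            moreover have "z j \<subseteq> ?I" using below[OF j(1)] Z(3)[of j] by simp
            ultimately have "z j = ?I"
              using Z(1) subI Z(2)[OF j(3)] by (intro vec.subspace_dim_equal) auto
            then show False using Suc y1z y1[of j] by auto
          qed
          then have "?I = y (Suc j)" "?I = z (Suc j)"
            using subI Y(1) Z(1) Y(2)[OF j(2)] Z(2)[OF j(2)]
            by (intro vec.subspace_dim_equal; simp)+
          then show False using differ[OF j(1)] by simp
        qed
      qed
      then have not_in: "\<not> y (Suc 0) \<subseteq> x (Suc k)"
        using zx[of "Suc k"] by auto
      have zc: "z j = x (Suc k) \<inter> y (Suc j)" if "j \<le> k" for j
      proof (rule vec.subspace_dim_equal[OF Z(1) sub])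
        show "z j \<subseteq> x (Suc k) \<inter> y (Suc j)"
          using below[of j] Z(4)[of j "Suc k"] zx[of "Suc k"] that by simp
        show "vec.dim (x (Suc k) \<inter> y (Suc j)) \<le> vec.dim (z j)"
          using dim_le[OF not_in that] Z(2)[of j] that Suc.prems(2) by simp
      qed
      have "z = c"
      proof
        fix j show "z j = c j" using zc zx by (cases "j \<le> k") (simp_all add: c_def)
      qed
      moreover have "x j = y j" if "j > Suc k" for j
        using zx[of j] zy[of j] that by simp
      moreover have "x a \<inter> y (Suc (Suc k) - a) = {0}" if a: "a \<le> Suc (Suc k)" for a
      proof -
        consider "a = 0" | "a = Suc (Suc k)" | "0 < a" "a \<le> Suc k" using a by linarith
        then show ?thesis
        proof cases
          case 1
          then show ?thesis using X(5) Y(7) by auto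
        next
          case 2
          then show ?thesis using X(7) Y(5) by auto
        next
          case 3
          have "x a \<subseteq> x (Suc k)" using X(4) 3 by simp
          then have "x a \<inter> y (Suc (Suc k) - a) = x a \<inter> (x (Suc k) \<inter> y (Suc (Suc k - a)))"
            using 3 by (simp add: Suc_diff_le) blast
          also have "\<dots> = x a \<inter> z (Suc k - a)"
            using zc[of "Suc k - a"] 3 by simp
          also have "\<dots> = {0}" using opp 3 by simp
          finally show ?thesis .
        qed
      qed
      ultimately show ?R by blast
    next
      assume R: ?R
      then have xy: "\<And>j. j > Suc k \<Longrightarrow> x j = y j" and zc: "z = c"
        and opp: "\<And>a. a \<le> Suc (Suc k) \<Longrightarrow> x a \<inter> y (Suc (Suc k) - a) = {0}"
        by auto
      have not_in: "\<not> y (Suc 0) \<subseteq> x (Suc k)"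
        using opp[of "Suc k"] y1_nz by auto
      have f1: "x j = z j" if "j > k" for j
        using that by (simp add: zc c_def)
      have f2: "x a \<inter> z (Suc k - a) = {0}" if a: "a \<le> Suc k" for a
      proof (cases "a = 0")
        case True
        then show ?thesis using X(5) Z(7) by auto
      next
        case False
        then have "Suc k - a \<le> k" "Suc (Suc k - a) = Suc (Suc k) - a" using a by auto
        then have "x a \<inter> z (Suc k - a) \<subseteq> x a \<inter> y (Suc (Suc k) - a)"
          by (auto simp: zc c_def)
        moreover have "0 \<in> x a \<inter> z (Suc k - a)" using X(7) Z(7) by simp
        ultimately show ?thesis using opp[of a] a by auto
      qed
      have f3: "z j \<subseteq> y (Suc j)" if "j < Suc k" for j
        using that by (auto simp: zc c_def)
      have f4: "z (Suc j) \<noteq> y (Suc j)" if "j < Suc k" for j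
      proof -
        have "z (Suc j) \<subseteq> x (Suc k)"
          using that X(4)[of "Suc j" "Suc k"] by (auto simp: zc c_def)
        then show ?thesis using not_in y1[of j] by auto
      qed
      have f5: "z j = y j" if "j > Suc k" for j
        using that xy by (simp add: zc c_def)
      show ?L by (intro conjI allI impI; erule f1 f2 f3 f4 f5)
    qed
  next
    assume H: "?H (Suc k) y"
    then have "x (Suc k) \<inter> y (Suc (Suc k) - Suc k) = {0}"
      by (meson le_SucI order_refl)
    then have not_in: "\<not> y (Suc 0) \<subseteq> x (Suc k)"
      using y1_nz by auto
    have dim_c: "vec.dim (x (Suc k) \<inter> y (Suc j)) = j" if j: "j \<le> k" for j
    proof -
      let ?U = "x (Suc (Suc k))"
      have "y (Suc j) \<subseteq> ?U"
        using H Y(4)[of "Suc j" "Suc (Suc k)"] j by simp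
      then have "vec.dim (x (Suc k)) + vec.dim (y (Suc j)) \<le> vec.dim ?U + vec.dim (x (Suc k) \<inter> y (Suc j))"
        by (intro dim_plus_dim_le X(1) Y(1) X(3))
      then show ?thesis
        using dim_le[OF not_in j] X(2)[of "Suc k"] X(2)[of "Suc (Suc k)"] Y(2)[of "Suc j"] j Suc.prems(2)
        by simp
    qed
    have "complete_flag c"
      unfolding complete_flag_def
    proof
      fix j
      consider "j < k" | "j = k" | "j > k" by linarith
      then show "vec.subspace (c j) \<and> vec.dim (c j) = min j CARD('n) \<and> c j \<subseteq> c (Suc j)"
      proof cases
        case 1
        then show ?thesis
          using sub dim_c[of j] Y(3)[of "Suc j"] Suc.prems(2) by (auto simp: c_def)
      next
        case 2
        then show ?thesis
          using sub dim_c[of k] Suc.prems(2) by (auto simp: c_def)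
      next
        case 3
        then show ?thesis
          using x unfolding complete_flag_def by (simp add: c_def)
      qed
    qed
    then show "c \<in> flags" by simp
  qed
  finally show ?case .
qed

section \<open>Closed galleries of an irreducible matrix\<close>

text \<open>
  Irreducibility of the representation of the polynomial ring that the matrix defines.
\<close>

definition irreducible_matrix :: "'a::field^'n^'n \<Rightarrow> bool" where
  "irreducible_matrix g \<longleftrightarrow>
     (\<forall>W. vec.subspace W \<longrightarrow> (*v) g ` W \<subseteq> W \<longrightarrow> W = {0} \<or> W = UNIV)"

lemma irreducible_matrix_dim:
  fixes g :: "'a::field^'n^'n"
  assumes "irreducible_matrix g" "vec.subspace W" "(*v) g ` W \<subseteq> W"
  shows "vec.dim W = 0 \<or> vec.dim W = CARD('n)"
proof -
  have "W = {0} \<or> W = UNIV"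
    using assms unfolding irreducible_matrix_def by simp
  then show ?thesis
    using dim_zero_iff[OF assms(2)] dim_eq_CARD_iff[OF assms(2)] by simp
qed

lemma irreducible_matrix_moves_flag:
  fixes g :: "'a::field^'n^'n"
  assumes irr: "irreducible_matrix g" and x: "complete_flag x" and k: "0 < k" "k < CARD('n)"
  shows "\<not> flag_image g x k \<subseteq> x k"
proof
  note X = complete_flagD[OF x]
  assume "flag_image g x k \<subseteq> x k"
  then have "vec.dim (x k) = 0 \<or> vec.dim (x k) = CARD('n)"
    unfolding flag_image_def by (rule irreducible_matrix_dim[OF irr X(1)])
  then show False using X(2)[of k] k by simp
qed

text \<open>
  The trace of the Hecke operator of \<open>w\<close> composed with the action of \<open>g\<close> on flags.
\<close>

definition closed_gallery_count :: "'a::{field,finite}^'n^'n \<Rightarrow> nat list \<Rightarrow> real" where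
  "closed_gallery_count g w = (\<Sum>x\<in>flags. gallery_count w x (flag_image g x))"

text \<open>
  The trace property: the action of \<open>g\<close> commutes with the Hecke operators.
\<close>

lemma closed_gallery_count_rotate:
  fixes g :: "'a::{field,finite}^'n^'n"
  assumes g: "invertible g"
  shows "closed_gallery_count g (u @ v) = closed_gallery_count g (v @ u)"
proof -
  let ?h = "flag_image g"
  have "closed_gallery_count g (u @ v) =
      (\<Sum>x\<in>flags. \<Sum>z\<in>flags. gallery_count u x z * gallery_count v z (?h x))"
    unfolding closed_gallery_count_def
    by (intro sum.cong refl) (simp add: gallery_count_append)
  also have "\<dots> = (\<Sum>z\<in>flags. \<Sum>x\<in>flags. gallery_count u x z * gallery_count v z (?h x))"
    by (rule sum.swap)
  also have "\<dots> = (\<Sum>z\<in>flags. \<Sum>x\<in>flags. gallery_count v z (?h x) * gallery_count u (?h x) (?h z))"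
    by (simp only: gallery_count_flag_image[OF g] mult.commute)
  also have "\<dots> = (\<Sum>z\<in>flags. \<Sum>x\<in>flags. gallery_count v z x * gallery_count u x (?h z))"
    by (intro sum.cong refl sum.reindex_bij_betw[OF bij_betw_flag_image[OF g]])
  also have "\<dots> = closed_gallery_count g (v @ u)"
    unfolding closed_gallery_count_def
    by (intro sum.cong refl) (simp add: gallery_count_append)
  finally show ?thesis .
qed

lemma elliptic_trace_closed_gallery_count:
  fixes g :: "'a::{field,finite}^'n^'n"
  assumes g: "invertible g" and irr: "irreducible_matrix g" and n: "CARD('n) = Suc m"
  shows "elliptic_trace (real CARD('a)) m (closed_gallery_count g)"
proof -
  let ?q = "real CARD('a)" and ?h = "flag_image g"
  have square: "gallery_count (u @ [i, i] @ v) x y =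
      (?q - 1) * gallery_count (u @ [i] @ v) x y + ?q * gallery_count (u @ v) x y"
    if "i < m" "complete_flag x" for u v i and x y :: "nat \<Rightarrow> ('a^'n) set"
  proof -
    have "(\<Sum>z\<in>flags. \<Sum>w\<in>flags. gallery_count u x z * (gallery_count [i, i] z w * gallery_count v w y)) =
      (\<Sum>z\<in>flags. \<Sum>w\<in>flags. (?q - 1) * (gallery_count u x z * (gallery_count [i] z w * gallery_count v w y)) +
        ?q * (gallery_count u x z * (gallery_count [] z w * gallery_count v w y)))"
    proof (intro sum.cong refl)
      fix z w :: "nat \<Rightarrow> ('a^'n) set" assume "z \<in> flags" "w \<in> flags"
      then have "gallery_count [i, i] z w = (?q - 1) * gallery_count [i] z w + ?q * gallery_count [] z w"
        using n \<open>i < m\<close> by (intro gallery_count_square) auto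
      then show "gallery_count u x z * (gallery_count [i, i] z w * gallery_count v w y) =
        (?q - 1) * (gallery_count u x z * (gallery_count [i] z w * gallery_count v w y)) +
        ?q * (gallery_count u x z * (gallery_count [] z w * gallery_count v w y))"
        by (simp only:) (simp add: algebra_simps del: gallery_count.simps)
    qed
    also have "\<dots> = (?q - 1) * gallery_count (u @ [i] @ v) x y + ?q * gallery_count (u @ [] @ v) x y"
      unfolding gallery_count_context[OF that(2)] by (simp only: sum.distrib sum_distrib_left)
    finally show ?thesis
      unfolding gallery_count_context[OF that(2), of u "[i, i]"] by simp
  qed
  have "hecke_functional ?q m (closed_gallery_count g)"
    unfolding hecke_functional_def
  proof (intro conjI allI impI)
    fix u v i assume i: "i < m"
    show "closed_gallery_count g (u @ [i, i] @ v) =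
        (?q - 1) * closed_gallery_count g (u @ [i] @ v) + ?q * closed_gallery_count g (u @ v)"
      unfolding closed_gallery_count_def sum_distrib_left sum.distrib[symmetric]
      using square[OF i] by (intro sum.cong refl) simp
  next
    fix u v i assume i: "Suc i < m"
    then have "gallery_count [i, Suc i, i] z w = gallery_count [Suc i, i, Suc i] z w"
      if "complete_flag z" "complete_flag w" for z w :: "nat \<Rightarrow> ('a^'n) set"
      using n that by (intro gallery_count_braid) auto
    from gallery_count_replace[OF this]
    show "closed_gallery_count g (u @ [i, Suc i, i] @ v) = closed_gallery_count g (u @ [Suc i, i, Suc i] @ v)"
      unfolding closed_gallery_count_def by (intro sum.cong refl) simp
  next
    fix u v i j assume ij: "Suc i < j" "j < m"
    then have "gallery_count [i, j] z w = gallery_count [j, i] z w"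
      if "complete_flag z" "complete_flag w" for z w :: "nat \<Rightarrow> ('a^'n) set"
      using n that by (intro gallery_count_commute) auto
    from gallery_count_replace[OF this]
    show "closed_gallery_count g (u @ [i, j] @ v) = closed_gallery_count g (u @ [j, i] @ v)"
      unfolding closed_gallery_count_def by (intro sum.cong refl) simp
  qed
  moreover have "closed_gallery_count g (i # w) = closed_gallery_count g (w @ [i])" for i w
    using closed_gallery_count_rotate[OF g, of "[i]" w] by simp
  moreover have "closed_gallery_count g w = 0" if "i < m" "i \<notin> set w" for i w
    unfolding closed_gallery_count_def
  proof (rule sum.neutral, rule ballI, rule ccontr)
    fix x :: "nat \<Rightarrow> ('a^'n) set" assume x: "x \<in> flags" and "gallery_count w x (?h x) \<noteq> 0"
    then have "x (Suc i) = ?h x (Suc i)"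
      using gallery_count_missing_letter[OF that(2)] by blast
    then show False
      using irreducible_matrix_moves_flag[OF irr, of x "Suc i"] x that(1) n by simp
  qed
  ultimately show ?thesis unfolding elliptic_trace_def by blast
qed

text \<open>
  If \<open>x (Suc k)\<close> contains \<open>x k\<close> and its image, it is their sum for reasons of dimension, because
  \<open>g\<close> does not stabilise \<open>x k\<close>. So these flags are determined by their lines.
\<close>

lemma krylov_flag_step:
  fixes g :: "'a::field^'n^'n"
  assumes g: "invertible g" and irr: "irreducible_matrix g" and x: "complete_flag x"
    and step: "flag_image g x k \<subseteq> x (Suc k)" and k: "0 < k" "k < CARD('n)"
  shows "x (Suc k) = {a + b |a b. a \<in> x k \<and> b \<in> flag_image g x k}"
proof -
  note X = complete_flagD[OF x] and G = complete_flagD[OF complete_flag_image[OF g x]]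
  let ?S = "{a + b |a b. a \<in> x k \<and> b \<in> flag_image g x k}"
  have sub: "vec.subspace ?S" using X(1) G(1) by (intro vec.subspace_sums)
  have S: "x k \<subseteq> ?S" "flag_image g x k \<subseteq> ?S" using X(7) G(7) by force+
  have le: "?S \<subseteq> x (Suc k)" using step X(3) X(1) vec.subspace_add by blast
  have "Suc k \<le> vec.dim ?S"
  proof (rule ccontr)
    assume "\<not> ?thesis"
    then have "x k = ?S"
      using X(1) X(2)[of k] k S(1) sub by (intro vec.subspace_dim_equal) auto
    with S(2) show False using irreducible_matrix_moves_flag[OF irr x k] by simp
  qed
  then show ?thesis
    using sub X(1) X(2)[of "Suc k"] k le by (intro vec.subspace_dim_equal[symmetric]) auto
qed

text \<open>
  The spans of the first iterates of \<open>v\<close>. They grow by one dimension in each step, as a span that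
  contains the next iterate is stable under \<open>g\<close>.
\<close>

lemma krylov_flag_exists:
  fixes g :: "'a::field^'n^'n"
  assumes irr: "irreducible_matrix g" and v: "v \<noteq> 0"
  obtains x where "complete_flag x" "\<And>j. flag_image g x j \<subseteq> x (Suc j)" "x (Suc 0) = vec.span {v}"
proof
  define p where "p j = ((*v) g ^^ j) v" for j
  define x where "x k = vec.span (p ` {..<k})" for k
  have step: "flag_image g x j \<subseteq> x (Suc j)" for j
  proof -
    have "(*v) g ` p ` {..<j} \<subseteq> p ` {..<Suc j}"
      by (force simp: p_def)
    then have "vec.span ((*v) g ` p ` {..<j}) \<subseteq> vec.span (p ` {..<Suc j})"
      by (rule vec.span_mono)
    then show ?thesis
      unfolding flag_image_def x_def by (simp add: vec.span_image)
  qed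
  have x_Suc: "x (Suc k) = vec.span (insert (p k) (p ` {..<k}))" for k
    by (simp add: x_def lessThan_Suc)
  have dim: "vec.dim (x k) = min k CARD('n)" for k
  proof (induction k)
    case 0
    show ?case by (simp add: x_def)
  next
    case (Suc k)
    have "vec.dim (x (Suc k)) = (if p k \<in> x k then vec.dim (x k) else vec.dim (x k) + 1)"
      unfolding x_Suc by (simp add: vec.dim_insert x_def)
    moreover have "p k \<notin> x k" if "k < CARD('n)"
    proof
      assume pk: "p k \<in> x k"
      have "k \<noteq> 0"
      proof
        assume "k = 0"
        with pk v show False by (simp add: x_def p_def)
      qed
      have "x (Suc k) = x k"
        using pk unfolding x_Suc unfolding x_def by (rule vec.span_redundant)
      with step[of k] have "(*v) g ` x k \<subseteq> x k"
        by (simp add: flag_image_def)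
      then have "vec.dim (x k) = 0 \<or> vec.dim (x k) = CARD('n)"
        by (intro irreducible_matrix_dim[OF irr]) (simp_all add: x_def)
      then show False using Suc that \<open>k \<noteq> 0\<close> by simp
    qed
    moreover have "vec.dim (x (Suc k)) \<le> CARD('n)" by (rule dim_le_CARD)
    ultimately show ?case using Suc by (cases "k < CARD('n)") (auto split: if_splits)
  qed
  show "complete_flag x"
    unfolding complete_flag_def
  proof
    fix k
    have "x k \<subseteq> x (Suc k)" unfolding x_def by (intro vec.span_mono image_mono) auto
    then show "vec.subspace (x k) \<and> vec.dim (x k) = min k CARD('n) \<and> x k \<subseteq> x (Suc k)"
      using dim by (simp add: x_def)
  qed
  show "\<And>j. flag_image g x j \<subseteq> x (Suc j)" by (rule step)
  show "x (Suc 0) = vec.span {v}" by (simp add: x_def p_def lessThan_Suc)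
qed

lemma card_krylov_flags:
  fixes g :: "'a::{field,finite}^'n^'n"
  assumes g: "invertible g" and irr: "irreducible_matrix g"
  shows "card {x. complete_flag x \<and> (\<forall>j. flag_image g x j \<subseteq> x (Suc j))} = (\<Sum>l<CARD('n). CARD('a) ^ l)"
proof -
  let ?K = "{x. complete_flag x \<and> (\<forall>j. flag_image g x j \<subseteq> x (Suc j))}"
  let ?L = "{W :: ('a^'n) set. vec.subspace W \<and> {0} \<subseteq> W \<and> W \<subseteq> UNIV \<and> vec.dim W = Suc (vec.dim {0::'a^'n})}"
  have "bij_betw (\<lambda>x. x (Suc 0)) ?K ?L"
    unfolding bij_betw_def
  proof
    show "inj_on (\<lambda>x. x (Suc 0)) ?K"
    proof (rule inj_onI)
      fix x y assume "x \<in> ?K" "y \<in> ?K" and eq: "x (Suc 0) = y (Suc 0)"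
      then have x: "complete_flag x" "\<And>j. flag_image g x j \<subseteq> x (Suc j)"
        and y: "complete_flag y" "\<And>j. flag_image g y j \<subseteq> y (Suc j)" by auto
      have "x k = y k" for k
      proof (induction k)
        case 0
        show ?case using complete_flagD(5) x(1) y(1) by metis
      next
        case (Suc k)
        consider "k = 0" | "0 < k" "k < CARD('n)" | "CARD('n) \<le> k" by linarith
        then show ?case
        proof cases
          case 1
          then show ?thesis using eq by simp
        next
          case 2
          have "flag_image g x k = flag_image g y k" using Suc by (simp add: flag_image_def)
          then show ?thesis
            unfolding krylov_flag_step[OF g irr x 2] krylov_flag_step[OF g irr y 2] Suc by simp
        next
          case 3
          then show ?thesis
            using complete_flagD(6)[OF x(1), of "Suc k"] complete_flagD(6)[OF y(1), of "Suc k"] by simp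
        qed
      qed
      then show "x = y" by (rule ext)
    qed
    show "(\<lambda>x. x (Suc 0)) ` ?K = ?L"
    proof
      show "(\<lambda>x. x (Suc 0)) ` ?K \<subseteq> ?L"
      proof (rule image_subsetI)
        fix x assume "x \<in> ?K"
        then have x: "complete_flag x" by simp
        have "Suc 0 \<le> CARD('n)" by (simp add: Suc_leI)
        then show "x (Suc 0) \<in> ?L" using complete_flagD(1,2,7)[OF x, of "Suc 0"] by simp
      qed
      show "?L \<subseteq> (\<lambda>x. x (Suc 0)) ` ?K"
      proof
        fix W :: "('a^'n) set" assume "W \<in> ?L"
        then have W: "vec.subspace W" "vec.dim W = 1" by auto
        then obtain v where v: "v \<in> W" "v \<noteq> 0"
          using dim_zero_iff[OF W(1)] vec.subspace_0[OF W(1)] by fastforce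
        then have "vec.span {v} = W"
          using W vec.span_minimal[of "{v}" W] by (intro vec.subspace_dim_equal) auto
        moreover obtain x where "complete_flag x" "\<And>j. flag_image g x j \<subseteq> x (Suc j)" "x (Suc 0) = vec.span {v}"
          using krylov_flag_exists[OF irr v(2)] by blast
        ultimately show "W \<in> (\<lambda>x. x (Suc 0)) ` ?K" by blast
      qed
    qed
  qed
  then have "card ?K = card ?L" by (rule bij_betw_same_card)
  also have "\<dots> = (\<Sum>l<CARD('n). CARD('a) ^ l)"
    by (rule card_one_step_extensions) (simp_all add: card_cart_basis)
  finally show ?thesis .
qed

text \<open>
  Read backwards, a gallery of Coxeter type from \<open>x\<close> to its image is a descending one, and the
  condition for it says that \<open>x\<close> is the Krylov flag of its line.
\<close>

lemma closed_gallery_count_coxeter: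
  fixes g :: "'a::{field,finite}^'n^'n"
  assumes g: "invertible g" and irr: "irreducible_matrix g" and n: "CARD('n) = Suc m"
  shows "closed_gallery_count g [0..<m] = (\<Sum>l\<le>m. real CARD('a) ^ l)"
proof -
  have "gallery_count [0..<m] x (flag_image g x) = of_bool (\<forall>j. flag_image g x j \<subseteq> x (Suc j))"
    if x: "complete_flag x" for x :: "nat \<Rightarrow> ('a^'n) set"
  proof -
    note gx = complete_flag_image[OF g x]
    have top: "x j = UNIV" "flag_image g x j = UNIV" if "m < j" for j
      using that n complete_flagD(6)[OF x, of j] complete_flagD(6)[OF gx, of j] by simp_all
    have "gallery_count [0..<m] x (flag_image g x) = gallery_count (rev [0..<m]) (flag_image g x) x"
      by (rule gallery_count_rev[OF x gx, symmetric])
    also have "\<dots> = of_bool ((\<forall>j<m. flag_image g x j \<subseteq> x (Suc j) \<and> flag_image g x (Suc j) \<noteq> x (Suc j)) \<and>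
        (\<forall>j>m. flag_image g x j = x j))"
      using n by (intro gallery_count_descending[OF gx x]) simp
    also have "\<dots> = of_bool (\<forall>j. flag_image g x j \<subseteq> x (Suc j))"
    proof (intro arg_cong[where f = of_bool] iffI)
      assume L: "(\<forall>j<m. flag_image g x j \<subseteq> x (Suc j) \<and> flag_image g x (Suc j) \<noteq> x (Suc j)) \<and>
        (\<forall>j>m. flag_image g x j = x j)"
      show "\<forall>j. flag_image g x j \<subseteq> x (Suc j)"
      proof
        fix j show "flag_image g x j \<subseteq> x (Suc j)"
          using L top(1)[of "Suc j"] by (cases "j < m") auto
      qed
    next
      assume R: "\<forall>j. flag_image g x j \<subseteq> x (Suc j)"
      have "flag_image g x (Suc j) \<noteq> x (Suc j)" if "j < m" for j
        using irreducible_matrix_moves_flag[OF irr x, of "Suc j"] that n by auto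
      with R top show "(\<forall>j<m. flag_image g x j \<subseteq> x (Suc j) \<and> flag_image g x (Suc j) \<noteq> x (Suc j)) \<and>
        (\<forall>j>m. flag_image g x j = x j)" by simp
    qed
    finally show ?thesis .
  qed
  then have "closed_gallery_count g [0..<m] =
      (\<Sum>x\<in>flags. of_bool (\<forall>j. flag_image g x j \<subseteq> x (Suc j)))"
    unfolding closed_gallery_count_def by (intro sum.cong refl) simp
  also have "\<dots> = real (card (flags \<inter> {x. \<forall>j. flag_image g x j \<subseteq> x (Suc j)}))"
    by (intro sum_of_bool_eq finite_complete_flags)
  also have "flags \<inter> {x. \<forall>j. flag_image g x j \<subseteq> x (Suc j)} =
      {x. complete_flag x \<and> (\<forall>j. flag_image g x j \<subseteq> x (Suc j))}"
    by blast
  finally show ?thesis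
    using card_krylov_flags[OF g irr] n by (simp add: lessThan_Suc_atMost)
qed

definition opposite :: "(nat \<Rightarrow> ('a::field^'n) set) \<Rightarrow> (nat \<Rightarrow> ('a^'n) set) \<Rightarrow> bool" where
  "opposite x y \<longleftrightarrow> (\<forall>a\<le>CARD('n). x a \<inter> y (CARD('n) - a) = {0})"

text \<open>
  The flag in the middle of such a gallery is opposite to both ends.
\<close>

lemma closed_gallery_count_full_twist:
  fixes g :: "'a::{field,finite}^'n^'n"
  assumes g: "invertible g" and n: "CARD('n) = Suc m"
  shows "closed_gallery_count g (half_twist m @ rev (half_twist m)) =
    real (card {(x, y). complete_flag x \<and> complete_flag y \<and> opposite x y \<and> opposite (flag_image g x) y})"
proof -
  let ?h = "flag_image g"
  have opp: "gallery_count (half_twist m) x y = of_bool (opposite x y)"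
    if x: "complete_flag x" and y: "complete_flag y" for x y :: "nat \<Rightarrow> ('a^'n) set"
  proof -
    have "\<forall>j>m. x j = y j"
      using complete_flagD(6)[OF x] complete_flagD(6)[OF y] n by simp
    then show ?thesis
      using gallery_count_half_twist[OF x y, of m] n by (simp add: opposite_def)
  qed
  have "closed_gallery_count g (half_twist m @ rev (half_twist m)) =
      (\<Sum>x\<in>flags. \<Sum>y\<in>flags. of_bool (opposite x y \<and> opposite (?h x) y))"
    unfolding closed_gallery_count_def
  proof (intro sum.cong refl)
    fix x :: "nat \<Rightarrow> ('a^'n) set" assume "x \<in> flags"
    then have x: "complete_flag x" by simp
    note hx = complete_flag_image[OF g x]
    have "gallery_count (half_twist m @ rev (half_twist m)) x (?h x) =
        (\<Sum>y\<in>flags. gallery_count (half_twist m) x y * gallery_count (rev (half_twist m)) y (?h x))"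
      by (rule gallery_count_append[OF x])
    also have "\<dots> = (\<Sum>y\<in>flags. of_bool (opposite x y \<and> opposite (?h x) y))"
      using opp[OF x] opp[OF hx] gallery_count_rev[OF hx]
      by (intro sum.cong refl) simp
    finally show "gallery_count (half_twist m @ rev (half_twist m)) x (?h x) = \<dots>" .
  qed
  also have "\<dots> = (\<Sum>p\<in>flags \<times> flags. of_bool (case p of (x, y) \<Rightarrow> opposite x y \<and> opposite (?h x) y))"
    by (simp only: sum.cartesian_product split_def)
  also have "\<dots> = real (card ((flags \<times> flags) \<inter> {p. case p of (x, y) \<Rightarrow> opposite x y \<and> opposite (?h x) y}))"
    by (intro sum_of_bool_eq finite_cartesian_product finite_complete_flags)
  also have "(flags \<times> flags) \<inter> {p. case p of (x, y) \<Rightarrow> opposite x y \<and> opposite (?h x) y} =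
      {(x, y). complete_flag x \<and> complete_flag y \<and> opposite x y \<and> opposite (?h x) y}"
    by blast
  finally show ?thesis .
qed

section \<open>Factorizations into reflections and opposite flags\<close>

lemma foldr_matrix_mult_snoc:
  fixes t :: "'a::field^'n^'n"
  shows "foldr (**) (ts @ [t]) (Finite_Cartesian_Product.mat 1) =
    foldr (**) ts (Finite_Cartesian_Product.mat 1) ** t"
  by (induction ts) (simp_all add: matrix_mul_assoc)

lemma invertible_iff_kernel:
  fixes A :: "'a::field^'n^'n"
  shows "invertible A \<longleftrightarrow> (\<forall>v. A *v v = 0 \<longrightarrow> v = 0)"
  by (simp add: invertible_left_inverse matrix_left_invertible_ker)

lemma subspace_fixed_space: "vec.subspace (fixed_space (A :: 'a::field^'n^'n))"
  unfolding fixed_space_def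
  by (rule vec.subspaceI) (simp_all add: matrix_vector_right_distrib vector_scalar_commute)

lemma subspace_equalizer: "vec.subspace {v. A *v v = (g :: 'a::field^'n^'n) *v v}"
  by (rule vec.subspaceI) (simp_all add: matrix_vector_right_distrib vector_scalar_commute)

lemma matrix_cancel_left:
  fixes A :: "'a::field^'n^'n"
  assumes "invertible A"
  shows "A *v v = A *v w \<longleftrightarrow> v = w" and "A ** s = A ** t \<longleftrightarrow> s = t"
proof -
  show *: "A *v v = A *v w \<longleftrightarrow> v = w" for v w
    using inj_invertible[OF assms] by (rule inj_eq)
  show "A ** s = A ** t \<longleftrightarrow> s = t"
  proof
    assume eq: "A ** s = A ** t"
    have "A *v (s *v v) = A *v (t *v v)" for v
      by (simp add: matrix_vector_mul_assoc eq)
    then show "s = t" by (simp add: matrix_eq *)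
  qed simp
qed

text \<open>
  The products \<open>A k\<close> of the first \<open>k\<close> factors of a factorization of \<open>g\<close> into as many reflections as
  the dimension. The factors themselves can be recovered from them.
\<close>

locale partial_products =
  fixes g :: "'a::field^'n^'n" and A :: "nat \<Rightarrow> 'a^'n^'n"
  assumes no_fixed: "\<And>v. g *v v = v \<Longrightarrow> v = 0"
    and first: "A 0 = Finite_Cartesian_Product.mat 1" and last: "A CARD('n) = g"
    and step: "\<And>k. k < CARD('n) \<Longrightarrow> \<exists>t. is_reflection t \<and> A (Suc k) = A k ** t"
begin

lemma invertible_partial_product: "k \<le> CARD('n) \<Longrightarrow> invertible (A k)"
proof (induction k)
  case 0
  show ?case by (simp add: first invertible_iff_kernel)
next
  case (Suc k)
  then obtain t where "is_reflection t" "A (Suc k) = A k ** t"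
    using step[of k] by auto
  then show ?case using Suc by (simp add: is_reflection_def invertible_mult)
qed

text \<open>
  Each reflection lowers the dimension of the space of fixed vectors by at most one.
\<close>

lemma dim_fix_ge: "k \<le> CARD('n) \<Longrightarrow> CARD('n) - k \<le> vec.dim (fixed_space (A k))"
proof (induction k)
  case 0
  have "fixed_space (A 0) = UNIV" by (simp add: first fixed_space_def)
  then show ?case using dim_eq_CARD_iff[OF subspace_fixed_space, of "A 0"] by simp
next
  case (Suc k)
  then obtain t where t: "is_reflection t" "A (Suc k) = A k ** t"
    using step[of k] by auto
  have "fixed_space (A k) \<inter> fixed_space t \<subseteq> fixed_space (A (Suc k))"
    by (auto simp: fixed_space_def t(2) matrix_vector_mul_assoc[symmetric])
  then have "vec.dim (fixed_space (A k) \<inter> fixed_space t) \<le> vec.dim (fixed_space (A (Suc k)))"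
    by (rule vec.dim_subset)
  moreover have "vec.dim (fixed_space (A k)) + vec.dim (fixed_space t) \<le>
      vec.dim (UNIV :: ('a^'n) set) + vec.dim (fixed_space (A k) \<inter> fixed_space t)"
    by (intro dim_plus_dim_le subspace_fixed_space) auto
  ultimately show ?case
    using Suc t(1) by (simp add: is_reflection_def card_cart_basis)
qed

definition agree :: "nat \<Rightarrow> ('a^'n) set" where
  "agree k = {v. A k *v v = g *v v}"

lemma subspace_agree: "vec.subspace (agree k)"
  unfolding agree_def by (rule subspace_equalizer)

lemma agree_step:
  assumes t: "A (Suc k) = A k ** t"
  shows "agree (Suc k) \<inter> fixed_space t \<subseteq> agree k"
  by (auto simp: agree_def fixed_space_def t matrix_vector_mul_assoc[symmetric])

lemma dim_agree_ge: "j \<le> CARD('n) \<Longrightarrow> CARD('n) - j \<le> vec.dim (agree (CARD('n) - j))"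
proof (induction j)
  case 0
  have "agree CARD('n) = UNIV" by (simp add: last agree_def)
  then show ?case using dim_eq_CARD_iff[OF subspace_agree, of "CARD('n)"] by simp
next
  case (Suc j)
  let ?k = "CARD('n) - Suc j"
  have k: "Suc ?k = CARD('n) - j" "?k < CARD('n)" using Suc by auto
  obtain t where t: "is_reflection t" "A (Suc ?k) = A ?k ** t"
    using step[OF k(2)] by auto
  have "vec.dim (agree (Suc ?k) \<inter> fixed_space t) \<le> vec.dim (agree ?k)"
    by (rule vec.dim_subset[OF agree_step[OF t(2)]])
  moreover have "vec.dim (agree (Suc ?k)) + vec.dim (fixed_space t) \<le>
      vec.dim (UNIV :: ('a^'n) set) + vec.dim (agree (Suc ?k) \<inter> fixed_space t)"
    by (intro dim_plus_dim_le subspace_fixed_space subspace_agree) auto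
  ultimately show ?case
    using Suc t(1) k(1) by (simp add: is_reflection_def card_cart_basis) arith
qed

lemma agree_Int_fix: "agree k \<inter> fixed_space (A k) = {0}"
  using no_fixed by (auto simp: agree_def fixed_space_def)

text \<open>
  A vector that \<open>A k\<close> fixes and on which it agrees with \<open>g\<close> is fixed by \<open>g\<close>, hence \<open>0\<close>. So the two
  lower bounds for the dimensions add up to the dimension of the whole space.
\<close>

lemma dim_agree_fixed:
  assumes k: "k \<le> CARD('n)"
  shows "vec.dim (agree k) = k" "vec.dim (fixed_space (A k)) = CARD('n) - k"
proof -
  have "k \<le> vec.dim (agree k)"
    using dim_agree_ge[of "CARD('n) - k"] k by simp
  moreover have "CARD('n) - k \<le> vec.dim (fixed_space (A k))"
    using dim_fix_ge[OF k] .
  moreover have "vec.dim (agree k) + vec.dim (fixed_space (A k)) \<le>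
      vec.dim (UNIV :: ('a^'n) set) + vec.dim (agree k \<inter> fixed_space (A k))"
    by (intro dim_plus_dim_le subspace_fixed_space subspace_agree) auto
  ultimately show "vec.dim (agree k) = k" "vec.dim (fixed_space (A k)) = CARD('n) - k"
    using k by (auto simp: agree_Int_fix card_cart_basis)
qed

text \<open>
  Intersecting with the hyperplane of the reflection \<open>t\<close> leads from one space into the next, and the
  exact dimensions turn this inclusion into an equality.
\<close>

lemma agree_fixed_chain:
  assumes k: "k < CARD('n)"
  shows "agree k \<subseteq> agree (Suc k)" "fixed_space (A (Suc k)) \<subseteq> fixed_space (A k)"
proof -
  obtain t where t: "is_reflection t" "A (Suc k) = A k ** t"
    using step[OF k] by auto
  have "vec.dim (agree (Suc k)) + vec.dim (fixed_space t) \<le>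
      vec.dim (UNIV :: ('a^'n) set) + vec.dim (agree (Suc k) \<inter> fixed_space t)"
    by (intro dim_plus_dim_le subspace_fixed_space subspace_agree) auto
  then have "vec.dim (agree k) \<le> vec.dim (agree (Suc k) \<inter> fixed_space t)"
    using t(1) k dim_agree_fixed(1)[of k] dim_agree_fixed(1)[of "Suc k"] by (simp add: is_reflection_def card_cart_basis)
  then have "agree (Suc k) \<inter> fixed_space t = agree k"
    using agree_step[OF t(2)]
    by (intro vec.subspace_dim_equal vec.subspace_inter subspace_fixed_space subspace_agree)
  then show "agree k \<subseteq> agree (Suc k)" by blast
  have "vec.dim (fixed_space (A k)) + vec.dim (fixed_space t) \<le>
      vec.dim (UNIV :: ('a^'n) set) + vec.dim (fixed_space (A k) \<inter> fixed_space t)"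
    by (intro dim_plus_dim_le subspace_fixed_space) auto
  then have "vec.dim (fixed_space (A (Suc k))) \<le> vec.dim (fixed_space (A k) \<inter> fixed_space t)"
    using t(1) k dim_agree_fixed(2)[of k] dim_agree_fixed(2)[of "Suc k"] by (simp add: is_reflection_def card_cart_basis)
  moreover have "fixed_space (A k) \<inter> fixed_space t \<subseteq> fixed_space (A (Suc k))"
    by (auto simp: fixed_space_def t(2) matrix_vector_mul_assoc[symmetric])
  ultimately have "fixed_space (A k) \<inter> fixed_space t = fixed_space (A (Suc k))"
    by (intro vec.subspace_dim_equal vec.subspace_inter subspace_fixed_space)
  then show "fixed_space (A (Suc k)) \<subseteq> fixed_space (A k)" by blast
qed

end

text \<open>
  The flag \<open>x\<close> of the introduction.
\<close>

definition agreement_flag :: "'a::field^'n^'n \<Rightarrow> (nat \<Rightarrow> 'a^'n^'n) \<Rightarrow> nat \<Rightarrow> ('a^'n) set" where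
  "agreement_flag g A k = (if k \<le> CARD('n) then {v. A k *v v = g *v v} else UNIV)"

text \<open>
  The flag \<open>y\<close> of the introduction, indexed by dimension rather than by codimension.
\<close>

definition fixed_flag :: "(nat \<Rightarrow> 'a::field^'n^'n) \<Rightarrow> nat \<Rightarrow> ('a^'n) set" where
  "fixed_flag A k = (if k \<le> CARD('n) then fixed_space (A (CARD('n) - k)) else UNIV)"

context partial_products
begin

lemma complete_flag_agreement: "complete_flag (agreement_flag g A)"
  unfolding complete_flag_def
proof
  fix k
  show "vec.subspace (agreement_flag g A k) \<and> vec.dim (agreement_flag g A k) = min k CARD('n) \<and>
      agreement_flag g A k \<subseteq> agreement_flag g A (Suc k)"
    using subspace_agree[of k] dim_agree_fixed(1)[of k] agree_fixed_chain(1)[of k]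
    by (auto simp: agreement_flag_def agree_def card_cart_basis)
qed

lemma complete_flag_fixed: "complete_flag (fixed_flag A)"
  unfolding complete_flag_def
proof
  fix k
  have "fixed_space (A (CARD('n) - k)) \<subseteq> fixed_space (A (CARD('n) - Suc k))" if "Suc k \<le> CARD('n)"
    using agree_fixed_chain(2)[of "CARD('n) - Suc k"] that by (simp add: Suc_diff_Suc)
  then show "vec.subspace (fixed_flag A k) \<and> vec.dim (fixed_flag A k) = min k CARD('n) \<and>
      fixed_flag A k \<subseteq> fixed_flag A (Suc k)"
    using subspace_fixed_space dim_agree_fixed(2)[of "CARD('n) - k"]
    by (auto simp: fixed_flag_def card_cart_basis)
qed

lemma opposite_agreement_fixed:
  "opposite (agreement_flag g A) (fixed_flag A)"
  "opposite (flag_image g (agreement_flag g A)) (fixed_flag A)"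
proof -
  show "opposite (agreement_flag g A) (fixed_flag A)"
    unfolding opposite_def
    using agree_Int_fix by (simp add: agreement_flag_def fixed_flag_def agree_def)
  show "opposite (flag_image g (agreement_flag g A)) (fixed_flag A)"
    unfolding opposite_def
  proof (intro allI impI)
    fix a assume a: "a \<le> CARD('n)"
    have "w = 0" if w: "w \<in> (*v) g ` agree a" "w \<in> fixed_space (A a)" for w
    proof -
      obtain v where v: "w = g *v v" "A a *v v = g *v v"
        using w(1) by (auto simp: agree_def)
      then have "A a *v w = A a *v v" using w(2) by (simp add: fixed_space_def)
      then have "w = v" using matrix_cancel_left(1)[OF invertible_partial_product[OF a]] by simp
      then show "w = 0" using v(1) no_fixed by simp
    qed
    moreover have "0 \<in> (*v) g ` agree a"
      by (rule image_eqI[where x = 0]) (simp_all add: agree_def)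
    moreover have "0 \<in> fixed_space (A a)" by (simp add: fixed_space_def)
    ultimately have "(*v) g ` agree a \<inter> fixed_space (A a) = {0}" by blast
    then show "flag_image g (agreement_flag g A) a \<inter> fixed_flag A (CARD('n) - a) = {0}"
      using a by (simp add: flag_image_def agreement_flag_def fixed_flag_def agree_def)
  qed
qed

end


lemma opposite_decompose:
  fixes x y :: "nat \<Rightarrow> ('a::field^'n) set"
  assumes x: "complete_flag x" and y: "complete_flag y" and opp: "opposite x y" and a: "a \<le> CARD('n)"
  obtains p s where "v = p + s" "p \<in> x a" "s \<in> y (CARD('n) - a)"
proof -
  note X = complete_flagD[OF x] and Y = complete_flagD[OF y]
  let ?S = "{p + s |p s. p \<in> x a \<and> s \<in> y (CARD('n) - a)}"
  have "vec.dim (x a \<inter> y (CARD('n) - a)) = 0"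
    using opp a by (simp add: opposite_def)
  then have "vec.dim ?S = CARD('n)"
    using vec.dim_sums_Int[OF X(1) Y(1), of a "CARD('n) - a"] X(2)[OF a]
      Y(2)[OF diff_le_self, of a] a by linarith
  then have "?S = UNIV"
    using dim_eq_CARD_iff[OF vec.subspace_sums[OF X(1) Y(1)], of a "CARD('n) - a"] by blast
  then have "v \<in> ?S" by simp
  then show thesis using that by blast
qed

text \<open>
  Opposite members of the two flags are complementary, so a linear map may be prescribed on each.
\<close>

lemma opposite_glue:
  fixes x y :: "nat \<Rightarrow> ('a::field^'n) set" and g :: "'a^'n^'n"
  assumes x: "complete_flag x" and y: "complete_flag y" and opp: "opposite x y" and a: "a \<le> CARD('n)"
  obtains A :: "'a^'n^'n" where "\<And>v. v \<in> x a \<Longrightarrow> A *v v = g *v v"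
    "\<And>v. v \<in> y (CARD('n) - a) \<Longrightarrow> A *v v = v"
proof -
  note X = complete_flagD[OF x] and Y = complete_flagD[OF y]
  let ?b = "CARD('n) - a"
  obtain B where B: "B \<subseteq> x a" "vec.independent B" "x a \<subseteq> vec.span B" "card B = vec.dim (x a)"
    using vec.basis_exists[of "x a"] by blast
  obtain C where C: "C \<subseteq> y ?b" "vec.independent C" "y ?b \<subseteq> vec.span C" "card C = vec.dim (y ?b)"
    using vec.basis_exists[of "y ?b"] by blast
  have fin: "finite B" "finite C" using B(2) C(2) vec.finiteI_independent by auto
  have "0 \<notin> B" using B(2) vec.dependent_zero by blast
  moreover have "x a \<inter> y ?b = {0}" using opp a unfolding opposite_def by (elim allE impE)
  then have "B \<inter> C \<subseteq> {0}" using Int_mono[OF B(1) C(1)] by simp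
  ultimately have disj: "B \<inter> C = {}" by auto
  have "vec.span (B \<union> C) = UNIV"
  proof -
    have "v \<in> vec.span (B \<union> C)" for v
    proof -
      obtain p s where v: "v = p + s" "p \<in> x a" "s \<in> y ?b"
        by (rule opposite_decompose[OF x y opp a])
      have "p \<in> vec.span (B \<union> C)" using v(2) B(3) vec.span_mono[of B "B \<union> C"] by blast
      moreover have "s \<in> vec.span (B \<union> C)" using v(3) C(3) vec.span_mono[of C "B \<union> C"] by blast
      ultimately show ?thesis unfolding v(1) by (rule vec.span_add)
    qed
    then show ?thesis by blast
  qed
  moreover have "card (B \<union> C) = CARD('n)"
    using fin disj B(4) C(4) X(2)[OF a] Y(2)[of ?b] a by (simp add: card_Un_disjoint)
  ultimately have indep: "vec.independent (B \<union> C)"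
    using fin by (intro vec.card_le_dim_spanning[of _ UNIV]) (simp_all add: card_cart_basis)
  obtain f where f: "Vector_Spaces.linear (*s) (*s) f" "\<forall>v\<in>B \<union> C. f v = (if v \<in> B then g *v v else v)"
    using vec.linear_independent_extend[OF indep, of "\<lambda>v. if v \<in> B then g *v v else v"] by blast
  have eqB: "f v = g *v v" if "v \<in> vec.span B" for v
    by (rule vec.linear_eq_on_span[OF f(1) matrix_vector_mul_linear_gen _ that]) (use f(2) in auto)
  have eqC: "f v = v" if "v \<in> vec.span C" for v
    by (rule vec.linear_eq_on_span[OF f(1) vec.linear_ident _ that]) (use f(2) disj in auto)
  show thesis
  proof (rule that[of "matrix f"])
    show "matrix f *v v = g *v v" if "v \<in> x a" for v
      using eqB that B(3) by (auto simp: matrix_works[OF f(1)])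
    show "matrix f *v v = v" if "v \<in> y ?b" for v
      using eqC that C(3) by (auto simp: matrix_works[OF f(1)])
  qed
qed

definition partial_product :: "('a::field^'n^'n) list \<Rightarrow> nat \<Rightarrow> 'a^'n^'n" where
  "partial_product ts k = foldr (**) (take k ts) (Finite_Cartesian_Product.mat 1)"

lemma partial_product_Suc:
  "k < length ts \<Longrightarrow> partial_product ts (Suc k) = partial_product ts k ** (ts ! k)"
  unfolding partial_product_def by (simp only: take_Suc_conv_app_nth foldr_matrix_mult_snoc)

lemma partial_products_factorization:
  fixes g :: "'a::field^'n^'n"
  assumes "\<And>v. g *v v = v \<Longrightarrow> v = 0" and ts: "ts \<in> reflection_factorizations g CARD('n)"
  shows "partial_products g (partial_product ts)"
proof
  show "\<And>v. g *v v = v \<Longrightarrow> v = 0" by (rule assms)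
  show "partial_product ts 0 = Finite_Cartesian_Product.mat 1" by (simp add: partial_product_def)
  show "partial_product ts CARD('n) = g"
    using ts by (simp add: partial_product_def reflection_factorizations_def)
  show "\<exists>t. is_reflection t \<and> partial_product ts (Suc k) = partial_product ts k ** t" if "k < CARD('n)" for k
    using ts that partial_product_Suc[of k ts]
    by (intro exI[of _ "ts ! k"]) (simp add: reflection_factorizations_def)
qed

definition factorization_flags :: "'a::field^'n^'n \<Rightarrow> ('a^'n^'n) list \<Rightarrow> (nat \<Rightarrow> ('a^'n) set) \<times> (nat \<Rightarrow> ('a^'n) set)" where
  "factorization_flags g ts = (agreement_flag g (partial_product ts), fixed_flag (partial_product ts))"

text \<open>
  On complementary subspaces a partial product is \<open>g\<close> and the identity, so the flags determine all
  partial products.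
\<close>

lemma inj_on_factorization_flags:
  fixes g :: "'a::field^'n^'n"
  assumes nofix: "\<And>v. g *v v = v \<Longrightarrow> v = 0"
  shows "inj_on (factorization_flags g) (reflection_factorizations g CARD('n))"
proof (rule inj_onI)
  fix ts us assume ts: "ts \<in> reflection_factorizations g CARD('n)"
    and us: "us \<in> reflection_factorizations g CARD('n)" and eq: "factorization_flags g ts = factorization_flags g us"
  interpret T: partial_products g "partial_product ts"
    by (rule partial_products_factorization[OF nofix ts])
  have len: "length ts = CARD('n)" "length us = CARD('n)"
    using ts us by (simp_all add: reflection_factorizations_def)
  have same: "partial_product ts k = partial_product us k" if k: "k \<le> CARD('n)" for k
  proof -
    have "partial_product ts k *v v = partial_product us k *v v" for v
    proof -
      obtain p s where v: "v = p + s" "p \<in> agreement_flag g (partial_product ts) k"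
        "s \<in> fixed_flag (partial_product ts) (CARD('n) - k)"
        by (rule opposite_decompose[OF T.complete_flag_agreement T.complete_flag_fixed
              T.opposite_agreement_fixed(1) k])
      moreover have "p \<in> agreement_flag g (partial_product us) k"
        "s \<in> fixed_flag (partial_product us) (CARD('n) - k)"
        using v eq by (simp_all add: factorization_flags_def)
      ultimately show ?thesis
        using k by (simp add: agreement_flag_def fixed_flag_def fixed_space_def matrix_vector_right_distrib)
    qed
    then show ?thesis by (simp add: matrix_eq)
  qed
  show "ts = us"
  proof (rule nth_equalityI)
    show "length ts = length us" using len by simp
    fix k assume "k < length ts"
    then have "partial_product ts k ** (ts ! k) = partial_product ts k ** (us ! k)"
      using partial_product_Suc[of k ts] partial_product_Suc[of k us] same[of k] same[of "Suc k"] len by simp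
    then show "ts ! k = us ! k"
      using matrix_cancel_left(2)[OF T.invertible_partial_product[of k], of "ts ! k" "us ! k"] \<open>k < length ts\<close> len by simp
  qed
qed

text \<open>
  The partial products are glued from \<open>g\<close> and the identity. They are invertible because \<open>y\<close> is opposite
  to the image of \<open>x\<close>. Consecutive ones agree on \<open>x k\<close> and on \<open>y (n - k - 1)\<close>, which span a
  hyperplane, and they differ because \<open>g\<close> has no fixed vector; so their quotient is a reflection.
\<close>

lemma factorization_flags_surj:
  fixes g :: "'a::field^'n^'n"
  assumes g: "invertible g" and nofix: "\<And>v. g *v v = v \<Longrightarrow> v = 0"
    and x: "complete_flag x" and y: "complete_flag y"
    and opp: "opposite x y" "opposite (flag_image g x) y"
  shows "(x, y) \<in> factorization_flags g ` reflection_factorizations g CARD('n)"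
proof -
  note X = complete_flagD[OF x] and Y = complete_flagD[OF y]
  have "\<exists>A. (\<forall>v\<in>x k. A *v v = g *v v) \<and> (\<forall>v\<in>y (CARD('n) - k). A *v v = v)" if "k \<le> CARD('n)" for k
    by (rule opposite_glue[OF x y opp(1) that, of g]) blast
  then obtain A where A: "\<And>k v. k \<le> CARD('n) \<Longrightarrow> v \<in> x k \<Longrightarrow> A k *v v = g *v v"
    "\<And>k v. k \<le> CARD('n) \<Longrightarrow> v \<in> y (CARD('n) - k) \<Longrightarrow> A k *v v = v"
    by metis
  have A_sum: "A k *v (p + s) = g *v p + s" if "k \<le> CARD('n)" "p \<in> x k" "s \<in> y (CARD('n) - k)" for k p s
    using A that by (simp add: matrix_vector_right_distrib)
  have g0: "g *v v = 0 \<longleftrightarrow> v = 0" for v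
    using g invertible_iff_kernel by fastforce
  have A_0: "A 0 = Finite_Cartesian_Product.mat 1"
    using A(2)[of 0] Y(6)[of "CARD('n)"] by (simp add: matrix_eq)
  have A_n: "A CARD('n) = g"
    using A(1)[of "CARD('n)"] X(6)[of "CARD('n)"] by (simp add: matrix_eq)
  have A_inv: "invertible (A k)" if k: "k \<le> CARD('n)" for k
    unfolding invertible_iff_kernel
  proof (intro allI impI)
    fix v assume v0: "A k *v v = 0"
    obtain p s where v: "v = p + s" "p \<in> x k" "s \<in> y (CARD('n) - k)"
      by (rule opposite_decompose[OF x y opp(1) k])
    then have "g *v p = - s" using v0 A_sum[OF k v(2,3)] by (simp add: eq_neg_iff_add_eq_0)
    then have "g *v p \<in> y (CARD('n) - k)" using v(3) Y(1) by (simp add: vec.subspace_neg)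
    moreover have "g *v p \<in> flag_image g x k" using v(2) by (simp add: flag_image_def)
    ultimately have "g *v p = 0" using opp(2) k unfolding opposite_def by blast
    with \<open>g *v p = - s\<close> show "v = 0" using g0 v(1) by simp
  qed
  have agree: "{v. A k *v v = g *v v} = x k" if k: "k \<le> CARD('n)" for k
  proof
    show "x k \<subseteq> {v. A k *v v = g *v v}" using A(1)[OF k] by auto
    show "{v. A k *v v = g *v v} \<subseteq> x k"
    proof
      fix v assume "v \<in> {v. A k *v v = g *v v}"
      moreover obtain p s where v: "v = p + s" "p \<in> x k" "s \<in> y (CARD('n) - k)"
        by (rule opposite_decompose[OF x y opp(1) k])
      ultimately have "g *v s = s"
        using A_sum[OF k v(2,3)] by (simp add: matrix_vector_right_distrib)
      then have "s = 0" by (rule nofix)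
      then show "v \<in> x k" using v by simp
    qed
  qed
  have fixed: "fixed_space (A k) = y (CARD('n) - k)" if k: "k \<le> CARD('n)" for k
    unfolding fixed_space_def
  proof
    show "y (CARD('n) - k) \<subseteq> {v. A k *v v = v}" using A(2)[OF k] by auto
    show "{v. A k *v v = v} \<subseteq> y (CARD('n) - k)"
    proof
      fix v assume "v \<in> {v. A k *v v = v}"
      moreover obtain p s where v: "v = p + s" "p \<in> x k" "s \<in> y (CARD('n) - k)"
        by (rule opposite_decompose[OF x y opp(1) k])
      ultimately have "g *v p = p"
        using A_sum[OF k v(2,3)] by simp
      then have "p = 0" by (rule nofix)
      then show "v \<in> y (CARD('n) - k)" using v by simp
    qed
  qed
  have "\<exists>t. is_reflection t \<and> A (Suc k) = A k ** t" if k: "k < CARD('n)" for k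
  proof -
    have k': "k \<le> CARD('n)" "Suc k \<le> CARD('n)" using k by auto
    obtain B where B: "A k ** B = Finite_Cartesian_Product.mat 1"
      using A_inv[OF k'(1)] unfolding invertible_def by blast
    define t where "t = B ** A (Suc k)"
    have t: "A (Suc k) = A k ** t"
      by (simp add: t_def matrix_mul_assoc B)
    have t_fix: "t *v v = v \<longleftrightarrow> A (Suc k) *v v = A k *v v" for v
      unfolding t using matrix_cancel_left(1)[OF A_inv[OF k'(1)]] by (simp add: matrix_vector_mul_assoc[symmetric])
    have "invertible t"
      using A_inv[OF k'(2)] unfolding t invertible_iff_kernel
      by (metis matrix_vector_mul_assoc matrix_vector_mult_0_right)
    moreover have "vec.dim (fixed_space t) = CARD('n) - 1"
    proof -
      have "x k \<subseteq> fixed_space t"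
        using A(1)[OF k'(1)] A(1)[OF k'(2)] X(3)[of k] by (auto simp: fixed_space_def t_fix)
      moreover have ysub: "y (CARD('n) - Suc k) \<subseteq> y (CARD('n) - k)"
        by (rule Y(4)) simp
      then have "y (CARD('n) - Suc k) \<subseteq> fixed_space t"
        using A(2)[OF k'(1)] A(2)[OF k'(2)] by (auto simp: fixed_space_def t_fix)
      ultimately have "vec.dim (x k) + vec.dim (y (CARD('n) - Suc k)) \<le>
          vec.dim (fixed_space t) + vec.dim (x k \<inter> y (CARD('n) - Suc k))"
        by (intro dim_plus_dim_le X(1) Y(1) subspace_fixed_space)
      moreover have "x k \<inter> y (CARD('n) - Suc k) = {0}"
        using opp(1) k'(1) ysub X(7) Y(7) unfolding opposite_def by blast
      ultimately have "CARD('n) - 1 \<le> vec.dim (fixed_space t)"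
        using X(2)[OF k'(1)] Y(2)[of "CARD('n) - Suc k"] k by simp
      moreover have "vec.dim (fixed_space t) \<noteq> CARD('n)"
      proof
        assume "vec.dim (fixed_space t) = CARD('n)"
        then have "fixed_space t = UNIV" using dim_eq_CARD_iff[OF subspace_fixed_space] by blast
        then have same: "A (Suc k) *v v = A k *v v" for v using t_fix by (auto simp: fixed_space_def)
        have "vec.dim (x (Suc k)) + vec.dim (y (CARD('n) - k)) \<le>
          vec.dim (UNIV :: ('a^'n) set) + vec.dim (x (Suc k) \<inter> y (CARD('n) - k))"
          by (intro dim_plus_dim_le X(1) Y(1)) auto
        then have dim_Int: "1 \<le> vec.dim (x (Suc k) \<inter> y (CARD('n) - k))"
          using X(2)[OF k'(2)] Y(2)[OF diff_le_self, of k] k by (simp add: card_cart_basis)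
        have "\<not> x (Suc k) \<inter> y (CARD('n) - k) \<subseteq> {0}"
        proof
          assume "x (Suc k) \<inter> y (CARD('n) - k) \<subseteq> {0}"
          then have "vec.dim (x (Suc k) \<inter> y (CARD('n) - k)) = 0" by (simp only: vec.dim_eq_0)
          with dim_Int show False by simp
        qed
        then obtain v where v: "v \<in> x (Suc k)" "v \<in> y (CARD('n) - k)" "v \<noteq> 0"
          by blast
        have "g *v v = v"
          using A(1)[OF k'(2) v(1)] A(2)[OF k'(1) v(2)] same by metis
        then show False using nofix v(3) by blast
      qed
      ultimately show ?thesis using dim_le_CARD[of "fixed_space t"] by simp
    qed
    ultimately show ?thesis using t unfolding is_reflection_def by blast
  qed
  then obtain t where t: "\<And>k. k < CARD('n) \<Longrightarrow> is_reflection (t k) \<and> A (Suc k) = A k ** t k"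
    by metis
  define ts where "ts = map t [0..<CARD('n)]"
  have prod: "partial_product ts k = A k" if "k \<le> CARD('n)" for k
    using that
  proof (induction k)
    case 0
    show ?case by (simp add: partial_product_def A_0)
  next
    case (Suc k)
    then show ?case using t[of k] partial_product_Suc[of k ts] by (simp add: ts_def)
  qed
  have "ts \<in> reflection_factorizations g CARD('n)"
    using prod[of "CARD('n)"] t A_n
    by (auto simp: reflection_factorizations_def partial_product_def ts_def)
  moreover have "factorization_flags g ts = (x, y)"
  proof -
    have "agreement_flag g (partial_product ts) k = x k" for k
      using agree prod[of k] X(6)[of k] by (simp add: agreement_flag_def)
    moreover have "fixed_flag (partial_product ts) k = y k" for k
      using fixed[of "CARD('n) - k"] prod[of "CARD('n) - k"] Y(6)[of k] by (simp add: fixed_flag_def)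
    ultimately show ?thesis by (simp add: factorization_flags_def fun_eq_iff)
  qed
  ultimately show ?thesis by force
qed

lemma card_reflection_factorizations_eq:
  fixes g :: "'a::field^'n^'n"
  assumes g: "invertible g" and nofix: "\<And>v. g *v v = v \<Longrightarrow> v = 0"
  shows "card (reflection_factorizations g CARD('n)) =
    card {(x, y). complete_flag x \<and> complete_flag y \<and> opposite x y \<and> opposite (flag_image g x) y}"
    (is "_ = card ?P")
proof -
  have "factorization_flags g ` reflection_factorizations g CARD('n) = ?P"
  proof
    show "factorization_flags g ` reflection_factorizations g CARD('n) \<subseteq> ?P"
    proof (rule image_subsetI)
      fix ts assume ts: "ts \<in> reflection_factorizations g CARD('n)"
      interpret partial_products g "partial_product ts"
        by (rule partial_products_factorization[OF nofix ts])
      show "factorization_flags g ts \<in> ?P"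
        using complete_flag_agreement complete_flag_fixed opposite_agreement_fixed
        by (simp add: factorization_flags_def)
    qed
    show "?P \<subseteq> factorization_flags g ` reflection_factorizations g CARD('n)"
      using factorization_flags_surj[OF g nofix] by blast
  qed
  then show ?thesis
    using card_image[OF inj_on_factorization_flags[OF nofix]] by metis
qed

section \<open>Singer cycles\<close>

text \<open>
  A stable subspace corresponds to a set of field elements that is closed under multiplication by the
  generator \<open>\<zeta>\<close>, and hence by all nonzero elements. If it contains a nonzero element, it is everything.
\<close>

lemma singer_cycle_irreducible:
  fixes c :: "'a::{field,finite}^'n^'n" and \<iota> :: "'a \<Rightarrow> 'b::{field,finite}"
  assumes "singer_cycle \<iota> c"
  shows "invertible c" "irreducible_matrix c"
proof -
  obtain \<phi> :: "'b \<Rightarrow> 'a^'n" and \<zeta> where \<phi>: "Vector_Spaces.linear (\<lambda>a x. \<iota> a * x) (*s) \<phi>" "bij \<phi>"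
    and \<zeta>: "generates_units \<zeta>" and c: "\<And>x. c *v \<phi> x = \<phi> (\<zeta> * x)"
    using assms unfolding singer_cycle_def by blast
  have "\<zeta> powi 1 \<in> UNIV - {0}"
    using \<zeta> unfolding generates_units_def by blast
  then have \<zeta>0: "\<zeta> \<noteq> 0" by simp
  have \<phi>0: "\<phi> x = 0 \<longleftrightarrow> x = 0" for x
    using Vector_Spaces.linear.axioms(3)[OF \<phi>(1), THEN module_hom.zero] bij_is_inj[OF \<phi>(2)] by (metis injD)
  show "invertible c"
    unfolding invertible_iff_kernel
  proof (intro allI impI)
    fix v assume "c *v v = 0"
    moreover obtain x where "v = \<phi> x" using bij_is_surj[OF \<phi>(2)] by (metis surjD)
    ultimately show "v = 0" using \<zeta>0 by (simp add: c \<phi>0)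
  qed
  show "irreducible_matrix c"
    unfolding irreducible_matrix_def
  proof (intro allI impI)
    fix W assume W: "vec.subspace W" and stable: "(*v) c ` W \<subseteq> W"
    define U where "U = {x. \<phi> x \<in> W}"
    \<comment> \<open>As \<open>U\<close> is finite, multiplication by \<open>\<zeta>\<close> permutes it, and \<open>U\<close> is closed under division by \<open>\<zeta>\<close>
      as well.\<close>
    have "(*) \<zeta> ` U \<subseteq> U" using stable c by (force simp: U_def)
    moreover have "inj_on ((*) \<zeta>) U" using \<zeta>0 by (simp add: inj_on_def)
    ultimately have U: "(*) \<zeta> ` U = U" by (intro endo_inj_surj) simp_all
    have up: "\<zeta> * x \<in> U" if "x \<in> U" for x
      using imageI[OF that, of "(*) \<zeta>"] unfolding U .
    have down: "x / \<zeta> \<in> U" if "x \<in> U" for x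
    proof -
      from that have "x \<in> (*) \<zeta> ` U" by (simp only: U)
      then obtain y where "y \<in> U" "x = \<zeta> * y" by (rule imageE)
      then show ?thesis using \<zeta>0 by simp
    qed
    show "W = {0} \<or> W = UNIV"
    proof (cases "W = {0}")
      case False
      then obtain w where "w \<in> W" "w \<noteq> 0" using vec.subspace_0[OF W] by blast
      moreover obtain x where "w = \<phi> x" using bij_is_surj[OF \<phi>(2)] by (metis surjD)
      ultimately have x: "x \<in> U" "x \<noteq> 0" by (auto simp: U_def \<phi>0)
      have pow: "\<zeta> powi k * x \<in> U" for k
      proof (induction k rule: int_induct[where k = 0])
        case base
        show ?case using x by simp
      next
        case (step1 i)
        then show ?case using up[of "\<zeta> powi i * x"] \<zeta>0 by (simp add: power_int_add mult_ac)
      next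
        case (step2 i)
        then show ?case using down[of "\<zeta> powi i * x"] \<zeta>0 by (simp add: power_int_diff)
      qed
      have "v \<in> W" for v
      proof -
        obtain y where v: "v = \<phi> y" using bij_is_surj[OF \<phi>(2)] by (metis surjD)
        have "y \<in> U"
        proof (cases "y = 0")
          case True
          then show ?thesis using \<phi>0[of 0] vec.subspace_0[OF W] by (simp add: U_def)
        next
          case False
          then have "y / x \<in> range (\<lambda>k::int. \<zeta> powi k)"
            using \<zeta> x(2) unfolding generates_units_def by simp
          then obtain k where "y / x = \<zeta> powi k" by blast
          then have "y = \<zeta> powi k * x" using x(2) by (simp add: field_simps)
          with pow show ?thesis by simp
        qed
        then show ?thesis by (simp add: U_def v)
      qed
      then show ?thesis by blast
    qed simp
  qed
qed

lemma irreducible_matrix_no_fixed_vector: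
  fixes g :: "'a::field^'n^'n"
  assumes irr: "irreducible_matrix g" and n: "CARD('n) \<ge> 2" and v: "g *v v = v"
  shows "v = 0"
proof (rule ccontr)
  assume "v \<noteq> 0"
  have "vec.span ((*v) g ` {v}) \<subseteq> vec.span {v}" using v by simp
  then have "(*v) g ` vec.span {v} \<subseteq> vec.span {v}" by (simp only: vec.span_image)
  then have "vec.dim (vec.span {v}) = 0 \<or> vec.dim (vec.span {v}) = CARD('n)"
    by (intro irreducible_matrix_dim[OF irr]) simp_all
  then show False using \<open>v \<noteq> 0\<close> n by simp
qed

text \<open>
  The three parts meet here: factorizations are pairs of opposite flags, these are closed galleries
  of the full twist, and closed galleries are an elliptic trace.
\<close>

lemma card_reflection_factorizations_irreducible:
  fixes g :: "'a::{field,finite}^'n^'n"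
  assumes g: "invertible g" and irr: "irreducible_matrix g" and n: "CARD('n) \<ge> 2"
  shows "card (reflection_factorizations g CARD('n)) = (CARD('a) ^ CARD('n) - 1) ^ (CARD('n) - 1)"
proof -
  let ?q = "real CARD('a)"
  obtain m where m: "CARD('n) = Suc m"
    using n by (cases "CARD('n)") auto
  have "?q \<noteq> 0" by simp
  have "real (card (reflection_factorizations g CARD('n))) =
      closed_gallery_count g (half_twist m @ rev (half_twist m))"
    unfolding closed_gallery_count_full_twist[OF g m]
    by (simp only: card_reflection_factorizations_eq[OF g irreducible_matrix_no_fixed_vector[OF irr n]])
  also have "\<dots> = (?q ^ Suc m - 1) ^ m"
    by (rule elliptic_trace_full_twist[OF \<open>?q \<noteq> 0\<close> elliptic_trace_closed_gallery_count[OF g irr m]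
          closed_gallery_count_coxeter[OF g irr m]])
  also have "\<dots> = real ((CARD('a) ^ Suc m - 1) ^ m)"
    by (simp add: of_nat_diff)
  finally show ?thesis
    unfolding m by (simp only: of_nat_eq_iff diff_Suc_1)
qed

theorem theorem1p1:
  fixes q n :: nat
    and \<iota> :: "'a::{field,finite} \<Rightarrow> 'b::{field,finite}"
    and c :: "'a^'n^'n"
  assumes "CARD('a) = q"
    and "CARD('n) = n"
    and "n \<ge> 2"
    and "CARD('b) = q ^ n"
    and "field_embedding \<iota>"
    and "singer_cycle \<iota> c"
  shows "card (reflection_factorizations c n) = (q ^ n - 1) ^ (n - 1)"
  using card_reflection_factorizations_irreducible[OF singer_cycle_irreducible[OF assms(6)]] assms(1-3)
  by simp

end
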